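(* Let $f\in\mathcal{A}$. Then for each $r\in\mathbb{N}$ and each $\sigma>0$, $$|R_\sigma(f)|\le \frac{1}{2^{r-1}}\sum_{k=1}^\infty \omega_r\Big(f;\frac{\pi}{\sigma k};L^1(\mathbb{R})\Big),$$ where the series on the right-hand side may be divergent (equal to $+\infty$).
   Context: Fourier transform: $\widehat f(v)=\frac{1}{\sqrt{2\pi}}\int_{\mathbb{R}} f(u)e^{-iuv}\,du$ for $f\in L^1(\mathbb{R})$. $C_b(\mathbb{R})$ is the class of continuous bounded functions $f:\mathbb{R}\to\mathbb{C}$. $\mathcal{A}=\{f\in L^1(\mathbb{R})\cap C_b(\mathbb{R}) : f\in \mathrm{BV}(\mathbb{R})\text{ or }\widehat f\in \mathrm{BV}(\mathbb{R})\}$, where $\mathrm{BV}(\mathbb{R})$ is the set of functions of bounded variation over $\mathbb{R}$. For $f\in\mathcal{A}$, $\sigma>0$ and $h=2\pi/\sigma$, $R_\sigma(f)$ denotes the remainder in the quadrature formula $\int_{-\infty}^\infty f(t)\,dt=h\sum_{k\in\mathbb{Z}}f(hk)+R_\sigma(f)$; by the Poisson summation formula, $R_\sigma(f)=-\sqrt{2\pi}\sum_{k\in\mathbb{Z}\setminus\{0\}}\widehat f(k\sigma)$. Modulus of smoothness of order $r\in\mathbb{N}$: for $f\in L^1(\mathbb{R})$ and $\delta>0$, $\omega_r(f;\delta;L^1(\mathbb{R}))=\sup_{|h|\le\delta}\|\Delta_h^r f\|_{L^1(\mathbb{R})}$, where $(\Delta_h^r f)(x)=\sum_{j=0}^r(-1)^{r-j}\binom{r}{j}f(x+jh)$.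 *)

theory Defs
  imports "HOL-Analysis.Analysis"
begin

definition fourier_transform :: "(real \<Rightarrow> complex) \<Rightarrow> real \<Rightarrow> complex" where
  "fourier_transform f v =
     complex_of_real (1 / sqrt (2 * pi)) *
       (LINT u|lborel. f u * exp (- (\<i> * complex_of_real (u * v))))"

definition bounded_variation :: "(real \<Rightarrow> complex) \<Rightarrow> bool" where
  "bounded_variation f \<longleftrightarrow>
     (\<exists>V. \<forall>(n::nat) (x::nat \<Rightarrow> real). mono_on {..n} x \<longrightarrow>
        (\<Sum>i<n. cmod (f (x (Suc i)) - f (x i))) \<le> V)"

definition class_A :: "(real \<Rightarrow> complex) set" where
  "class_A = {f. integrable lborel f \<and> continuous_on UNIV f \<and> bounded (range f) \<and>
                 (bounded_variation f \<or> bounded_variation (fourier_transform f))}"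

(* The sum over all integers is the limit of its symmetric partial sums, as in the Poisson
   summation formula. An unconditional sum (infsum) would be too narrow: when only the Fourier
   transform of f is known to have bounded variation, absolute convergence of the sum of
   f (h * k) is not evident. If the sum does converge absolutely, the two readings agree. *)
definition symmetric_int_sum :: "(int \<Rightarrow> complex) \<Rightarrow> complex" where
  "symmetric_int_sum a = lim (\<lambda>N::nat. \<Sum>k\<in>{- int N..int N}. a k)"

definition quadrature_remainder :: "real \<Rightarrow> (real \<Rightarrow> complex) \<Rightarrow> complex" where
  "quadrature_remainder \<sigma> f =
     (let h = 2 * pi / \<sigma> in
       (LINT t|lborel. f t) - complex_of_real h * symmetric_int_sum (\<lambda>k. f (h * real_of_int k)))"

definition forward_difference :: "nat \<Rightarrow> real \<Rightarrow> (real \<Rightarrow> complex) \<Rightarrow> real \<Rightarrow> complex" where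
  "forward_difference r h f x =
     (\<Sum>j\<le>r. (-1) ^ (r - j) * of_nat (r choose j) * f (x + real j * h))"

(* Values are taken in ennreal, so that the supremum and infinite series of moduli always exist. *)
definition modulus_of_smoothness_L1 :: "nat \<Rightarrow> (real \<Rightarrow> complex) \<Rightarrow> real \<Rightarrow> ennreal" where
  "modulus_of_smoothness_L1 r f \<delta> =
     (SUP h\<in>{h. \<bar>h\<bar> \<le> \<delta>}. \<integral>\<^sup>+ x. ennreal (cmod (forward_difference r h f x)) \<partial>lborel)"

end

theory Submission
  imports Defs
begin

text \<open>
  Write F(v) for the integral of f(u) exp(-iuv). A shift by pi/v multiplies the value of the
  transform at v by exp(i pi) = -1, so the r-th difference with this step has transform
  (-2)^r F(v) at v, and 2^r |F(k sigma)| is at most the modulus of smoothness at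
  pi/(|k| sigma). If the right-hand side is finite, the numbers F(k sigma) are therefore
  absolutely summable, and it remains to justify the Poisson summation formula for symmetric
  partial sums.

  Both halves of the class reduce to one statement about a continuous g of bounded variation
  whose symmetric sums of g(jp) converge: its periodization converges uniformly, the Fejer means
  of the periodization converge at 0, and since the Fourier coefficients are O(1/k), a Tauberian
  argument removes the Cesaro averaging. This applies to g = f with p = h and to the Fourier
  transform of f with p = sigma. In the second case the coefficients are principal-value
  integrals; they exist by uniform convergence, so their values may be found by Cesaro summation
  of the Fourier inversion integral.
\<close>

section \<open>The Fejer kernel\<close>

lemma sum_symmetric_Suc:
  fixes a :: "int \<Rightarrow> 'a::comm_monoid_add"
  shows "(\<Sum>k\<in>{- int (Suc N)..int (Suc N)}. a k) =
    (\<Sum>k\<in>{- int N..int N}. a k) + (a (int (Suc N)) + a (- int (Suc N)))"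
proof -
  have "{- int (Suc N)..int (Suc N)} = insert (int (Suc N)) (insert (- int (Suc N)) {- int N..int N})"
    by auto
  then show ?thesis by (simp add: ac_simps)
qed

lemma sum_symmetric_eq:
  fixes a :: "int \<Rightarrow> 'a::comm_monoid_add"
  shows "(\<Sum>k\<in>{- int N..int N}. a k) = a 0 + (\<Sum>i<N. a (int (Suc i)) + a (- int (Suc i)))"
proof (induction N)
  case (Suc N)
  show ?case unfolding sum_symmetric_Suc Suc.IH by (simp only: sum.lessThan_Suc ac_simps)
qed simp

text \<open>Enlarging the square by one row and one column adds the differences
  \<open>a - N\<close>, \<open>N - b\<close> and 0, which run exactly once through the integers from
  \<open>-N\<close> to \<open>N\<close>. This is what turns the squared modulus of a geometric sum
  into a sum of symmetric partial sums.\<close>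

lemma sum_differences_eq_sum_symmetric:
  fixes c :: "int \<Rightarrow> 'a::comm_monoid_add"
  shows "(\<Sum>a<N. \<Sum>b<N. c (int a - int b)) = (\<Sum>n<N. \<Sum>k\<in>{- int n..int n}. c k)"
proof (induction N)
  case (Suc N)
  have 1: "(\<Sum>a<N. c (int a - int N)) = (\<Sum>i<N. c (- int (Suc i)))"
    by (subst sum.nat_diff_reindex[symmetric]) (auto intro!: sum.cong simp: of_nat_diff)
  have 2: "(\<Sum>b<N. c (int N - int b)) = (\<Sum>i<N. c (int (Suc i)))"
    by (subst sum.nat_diff_reindex[symmetric]) (auto intro!: sum.cong simp: of_nat_diff)
  have "(\<Sum>a<Suc N. \<Sum>b<Suc N. c (int a - int b)) =
      (\<Sum>a<N. \<Sum>b<N. c (int a - int b)) + (c 0 + (\<Sum>i<N. c (int (Suc i)) + c (- int (Suc i))))"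
    using 1 2 by (simp add: sum.distrib ac_simps)
  then show ?case unfolding Suc.IH sum_symmetric_eq[of c N, symmetric] by simp
qed simp

text \<open>The square form makes nonnegativity evident; the form as a Cesaro mean of Dirichlet
  kernels is recovered in \<open>of_real_fejer_kernel\<close>. For \<open>N = 0\<close> the value is
  0.\<close>

definition fejer_kernel :: "nat \<Rightarrow> real \<Rightarrow> real" where
  "fejer_kernel N t = (cmod (\<Sum>a<N. cis (real a * t)))\<^sup>2 / real N"

lemma fejer_kernel_nonneg: "0 \<le> fejer_kernel N t"
  by (simp add: fejer_kernel_def)

lemma of_real_fejer_kernel:
  "complex_of_real (fejer_kernel N t) =
    (\<Sum>n<N. \<Sum>k\<in>{- int n..int n}. cis (of_int k * t)) / of_nat N"
proof -
  have "complex_of_real ((cmod (\<Sum>a<N. cis (real a * t)))\<^sup>2) =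
      (\<Sum>a<N. cis (real a * t)) * cnj (\<Sum>b<N. cis (real b * t))"
    by (rule complex_norm_square)
  also have "\<dots> = (\<Sum>a<N. \<Sum>b<N. cis (of_int (int a - int b) * t))"
    by (simp add: cis_cnj sum_product cis_mult left_diff_distrib)
  also have "\<dots> = (\<Sum>n<N. \<Sum>k\<in>{- int n..int n}. cis (of_int k * t))"
    by (rule sum_differences_eq_sum_symmetric)
  finally show ?thesis by (simp add: fejer_kernel_def)
qed

lemma cmod_one_minus_cis: "cmod (1 - cis t) = 2 * \<bar>sin (t / 2)\<bar>"
proof -
  have "(cmod (1 - cis t))\<^sup>2 = (1 - cos t)\<^sup>2 + (sin t)\<^sup>2"
    by (simp add: cmod_power2)
  also have "\<dots> = 2 - 2 * cos t"
    using sin_cos_squared_add[of t] by (simp add: power2_eq_square algebra_simps)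
  also have "\<dots> = (2 * \<bar>sin (t / 2)\<bar>)\<^sup>2"
    using cos_double_sin[of "t / 2"] by (simp add: power_mult_distrib)
  finally show ?thesis by (rule power2_eq_imp_eq) auto
qed

text \<open>Multiplication by \<open>1 - cis t\<close> telescopes the geometric sum to
  \<open>1 - cis (N * t)\<close>. The product form avoids a case distinction at the zeros of the
  sine.\<close>

lemma dirichlet_sum_sin_le: "cmod (\<Sum>a<N. cis (real a * t)) * \<bar>sin (t / 2)\<bar> \<le> 1"
proof -
  have "(1 - cis t) * (\<Sum>a<N. cis (real a * t)) = 1 - cis (real N * t)"
  proof -
    have "(\<Sum>a<N. cis (real a * t)) = (\<Sum>a<N. cis t ^ a)"
      by (intro sum.cong) (auto simp: Complex.DeMoivre)
    then show ?thesis using one_diff_power_eq[of "cis t" N] by (simp add: Complex.DeMoivre)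
  qed
  then have "cmod (\<Sum>a<N. cis (real a * t)) * (2 * \<bar>sin (t / 2)\<bar>) = 2 * \<bar>sin (real N * t / 2)\<bar>"
    by (metis cmod_one_minus_cis norm_mult mult.commute)
  moreover have "\<bar>sin (real N * t / 2)\<bar> \<le> 1" by (rule abs_sin_le_one)
  ultimately show ?thesis by linarith
qed

lemma fejer_kernel_sin_sq_le: "fejer_kernel N t * (sin (t / 2))\<^sup>2 \<le> 1 / real N"
proof -
  have "(cmod (\<Sum>a<N. cis (real a * t)) * \<bar>sin (t / 2)\<bar>)\<^sup>2 \<le> 1"
    by (rule power_le_one[OF _ dirichlet_sum_sin_le]) auto
  then show ?thesis
    by (simp add: fejer_kernel_def power_mult_distrib divide_right_mono)
qed

text \<open>One factor of the square is estimated by \<open>N\<close>, the other by the geometric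
  sum, so the bound is uniform in \<open>N\<close> and costs a single sine. In the inversion formula
  exactly one sine is available, from the integral of a character over a window.\<close>

lemma fejer_kernel_sin_le: "fejer_kernel N t * \<bar>sin (t / 2)\<bar> \<le> 1"
proof (cases "N = 0")
  case False
  let ?c = "cmod (\<Sum>a<N. cis (real a * t))"
  have "?c \<le> (\<Sum>a<N. 1)" by (rule sum_norm_le) simp
  then have "?c * (?c * \<bar>sin (t / 2)\<bar>) \<le> real N * 1"
    by (intro mult_mono dirichlet_sum_sin_le) auto
  then show ?thesis using False
    by (simp add: fejer_kernel_def power2_eq_square divide_le_eq mult.assoc)
qed (simp add: fejer_kernel_def)

lemma fejer_kernel_le: "fejer_kernel N t \<le> real N"
proof (cases "N = 0")
  case False
  have "cmod (\<Sum>a<N. cis (real a * t)) \<le> (\<Sum>a<N. 1)" by (rule sum_norm_le) simp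
  then have "(cmod (\<Sum>a<N. cis (real a * t)))\<^sup>2 \<le> (real N)\<^sup>2" by (intro power_mono) auto
  then show ?thesis using False by (simp add: fejer_kernel_def divide_le_eq power2_eq_square)
qed (simp add: fejer_kernel_def)

lemma continuous_on_fejer_kernel [continuous_intros]:
  "continuous_on S u \<Longrightarrow> continuous_on S (\<lambda>x. fejer_kernel N (u x))"
  unfolding fejer_kernel_def cis_conv_exp divide_inverse by (intro continuous_intros)

section \<open>Integrals of characters\<close>

lemma has_integral_cis:
  assumes "w \<noteq> 0" and "a \<le> b"
  shows "((\<lambda>v. cis (w * v)) has_integral (cis (w * b) - cis (w * a)) / (\<i> * w)) {a..b}"
proof -
  have "((\<lambda>v. exp (\<i> * w * of_real v) / (\<i> * w)) has_vector_derivative exp (\<i> * w * of_real x))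
      (at x within {a..b})" for x
    by (rule has_vector_derivative_real_field) (use assms in \<open>auto intro!: derivative_eq_intros\<close>)
  from fundamental_theorem_of_calculus[OF assms(2) this] show ?thesis
    by (simp add: cis_conv_exp diff_divide_distrib mult.assoc)
qed

lemma has_integral_cis_period:
  assumes "w * l = 2 * pi * of_int k" and "k \<noteq> 0" and "l \<ge> 0"
  shows "((\<lambda>v. cis (w * v)) has_integral 0) {a..a + l}"
proof -
  have "w \<noteq> 0" using assms by auto
  moreover have "cis (w * (a + l)) = cis (w * a)"
    using assms(1) by (simp add: distrib_left cis_mult[symmetric])
  ultimately show ?thesis using has_integral_cis[of w a "a + l"] assms(3) by simp
qed

section \<open>Periodization of functions of bounded variation\<close>

text \<open>The endpoints interleave to one monotone sequence
  \<open>a 0, b 0, a 1, b 1, ...\<close>; the gaps between the intervals only contribute further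
  nonnegative terms.\<close>

lemma sum_variation_intervals_le:
  fixes g :: "real \<Rightarrow> complex" and a b :: "nat \<Rightarrow> real"
  assumes var: "\<And>(n::nat) (x::nat \<Rightarrow> real). mono_on {..n} x \<Longrightarrow>
      (\<Sum>i<n. cmod (g (x (Suc i)) - g (x i))) \<le> V"
    and "\<And>i. a i \<le> b i" and "\<And>i. b i \<le> a (Suc i)"
  shows "(\<Sum>i<n. cmod (g (b i) - g (a i))) \<le> V"
proof -
  define x where "x k = (if even k then a (k div 2) else b (k div 2))" for k
  have "x k \<le> x (Suc k)" for k
    using assms(2)[of "k div 2"] assms(3)[of "k div 2"] by (auto simp: x_def elim!: oddE)
  then have "mono x" by (simp add: mono_iff_le_Suc)
  then have "mono_on {..2 * n} x" by (auto simp: mono_on_def mono_def)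
  from var[OF this] have V: "(\<Sum>i<2 * n. cmod (g (x (Suc i)) - g (x i))) \<le> V" .
  have pairs: "(\<Sum>i<2 * n. u i) = (\<Sum>i<n. u (2 * i) + u (Suc (2 * i)))" for u :: "nat \<Rightarrow> real"
    by (induction n) auto
  have "(\<Sum>i<n. cmod (g (b i) - g (a i))) \<le> (\<Sum>i<2 * n. cmod (g (x (Suc i)) - g (x i)))"
    unfolding pairs by (intro sum_mono) (simp add: x_def)
  with V show ?thesis by linarith
qed

text \<open>With half-integer multiples of \<open>p\<close> as limits, the interval consists of
  exactly \<open>2 * M + 1\<close> translates of the base interval, centred at the points
  \<open>j * p\<close> with \<open>j\<close> from \<open>-M\<close> to \<open>M\<close>.\<close>

lemma integral_unfold_periods:
  fixes \<phi> :: "real \<Rightarrow> complex"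
  assumes "continuous_on UNIV \<phi>" and "p > 0"
  shows "integral {- ((real M + 1/2) * p)..(real M + 1/2) * p} \<phi> =
    integral {- (p/2)..p/2} (\<lambda>v. \<Sum>j\<in>{- int M..int M}. \<phi> (v + of_int j * p))"
proof -
  have int: "\<phi> integrable_on {a..b}" for a b
    by (rule integrable_continuous_real) (rule continuous_on_subset[OF assms(1)], simp)
  have shift: "integral {a + c..b + c} \<phi> = integral {a..b} (\<lambda>v. \<phi> (v + c))" for a b c
    using integral_shift_Icc_real[of a b \<phi> c] by (simp add: o_def add.commute)
  have int': "(\<lambda>v. \<phi> (v + c)) integrable_on {a..b}" for a b c
    by (intro integrable_continuous_real continuous_intros continuous_on_compose2[OF assms(1)]) auto
  have "(\<Sum>j\<in>{- int M..int M}. integral {- (p/2)..p/2} (\<lambda>v. \<phi> (v + of_int j * p))) =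
     integral {- ((real M + 1/2) * p)..(real M + 1/2) * p} \<phi>"
  proof (induction M)
    case (Suc M)
    let ?r = "(real M + 1/2) * p"
    have "integral {- (?r + p)..?r + p} \<phi> = integral {- (?r + p)..?r} \<phi> + integral {?r..?r + p} \<phi>"
      using assms(2) by (intro Henstock_Kurzweil_Integration.integral_combine[symmetric] int) 
        (auto intro: order.trans[of _ 0])
    also have "integral {- (?r + p)..?r} \<phi> = integral {- (?r + p)..- ?r} \<phi> + integral {- ?r..?r} \<phi>"
      using assms(2) by (intro Henstock_Kurzweil_Integration.integral_combine[symmetric] int) auto
    also have "integral {- (?r + p)..- ?r} \<phi> = integral {- (p/2)..p/2} (\<lambda>v. \<phi> (v + of_int (- int (Suc M)) * p))"
      unfolding shift[symmetric] by (rule arg_cong2[where f = integral]) (auto simp: algebra_simps)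
    also have "integral {?r..?r + p} \<phi> = integral {- (p/2)..p/2} (\<lambda>v. \<phi> (v + of_int (int (Suc M)) * p))"
      unfolding shift[symmetric] by (rule arg_cong2[where f = integral]) (auto simp: algebra_simps)
    also have "?r + p = (real (Suc M) + 1/2) * p" by (simp add: algebra_simps)
    finally show ?case unfolding sum_symmetric_Suc Suc.IH by (simp add: ac_simps)
  qed simp
  then show ?thesis using int' by (simp add: integral_sum)
qed

text \<open>The variation bound is a parameter because it enters quantitatively, in the bound
  \<open>p * V / \<bar>k\<bar>\<close> for the Fourier coefficients.\<close>

locale continuous_bv =
  fixes g :: "real \<Rightarrow> complex" and V p :: real
  assumes cont: "continuous_on UNIV g"
    and var: "\<And>(n::nat) (x::nat \<Rightarrow> real). mono_on {..n} x \<Longrightarrow>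
      (\<Sum>i<n. cmod (g (x (Suc i)) - g (x i))) \<le> V"
    and period_pos: "p > 0"
begin

lemma cont_on [continuous_intros]: "continuous_on S u \<Longrightarrow> continuous_on S (\<lambda>x. g (u x))"
  by (rule continuous_on_compose2[OF cont]) auto

text \<open>By compactness the largest deviation from the central value is attained in each period
  cell. The segments from the centres to these maximizers do not overlap, so the deviations sum to
  at most \<open>V\<close>.\<close>

lemma summable_oscillation:
  obtains osc :: "int \<Rightarrow> real" where
    "\<And>j v. \<bar>v\<bar> \<le> p/2 \<Longrightarrow> cmod (g (v + of_int j * p) - g (of_int j * p)) \<le> osc j"
    "\<And>j. 0 \<le> osc j" "\<And>N. (\<Sum>j\<in>{- int N..int N}. osc j) \<le> V"
proof -
  have "\<exists>w\<in>{- (p/2)..p/2}. \<forall>v\<in>{- (p/2)..p/2}.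
      cmod (g (v + of_int j * p) - g (of_int j * p)) \<le> cmod (g (w + of_int j * p) - g (of_int j * p))" for j
    using period_pos by (intro continuous_attains_sup continuous_intros) auto
  then obtain w where w: "\<And>j. w j \<in> {- (p/2)..p/2}"
    "\<And>j v. v \<in> {- (p/2)..p/2} \<Longrightarrow> cmod (g (v + of_int j * p) - g (of_int j * p))
        \<le> cmod (g (w j + of_int j * p) - g (of_int j * p))"
    by metis
  define osc where "osc j = cmod (g (w j + of_int j * p) - g (of_int j * p))" for j
  have "(\<Sum>j\<in>{- int N..int N}. osc j) \<le> V" for N
  proof -
    let ?j = "\<lambda>i. int i - int N"
    let ?c = "\<lambda>i. of_int (?j i) * p"
    let ?d = "\<lambda>i. w (?j i) + ?c i"
    have "(\<Sum>j\<in>{- int N..int N}. osc j) = (\<Sum>i<Suc (2 * N). osc (?j i))"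
      by (rule sum.reindex_bij_witness[of _ ?j "\<lambda>j. nat (j + int N)"]) auto
    \<comment> \<open>A maximizer may lie on either side of its centre, so the endpoints are sorted
      first.\<close>
    also have "\<dots> = (\<Sum>i<Suc (2 * N). cmod (g (max (?c i) (?d i)) - g (min (?c i) (?d i))))"
      by (intro sum.cong) (auto simp: osc_def max_def min_def norm_minus_commute)
    also have "\<dots> \<le> V"
    proof (rule sum_variation_intervals_le[OF var])
      fix i
      have "w (?j i) \<le> p/2" "- (p/2) \<le> w (?j (Suc i))" using w(1) by auto
      then show "max (?c i) (?d i) \<le> min (?c (Suc i)) (?d (Suc i))"
        using period_pos by (auto simp: algebra_simps)
    qed auto
    finally show ?thesis .
  qed
  moreover have "cmod (g (v + of_int j * p) - g (of_int j * p)) \<le> osc j" if "\<bar>v\<bar> \<le> p/2" for j v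
    unfolding osc_def using that by (intro w(2)) auto
  ultimately show thesis by (intro that[of osc]) (auto simp: osc_def)
qed

text \<open>Pairing \<open>j\<close> with \<open>-j\<close> gives an ordinary series dominated by
  the oscillations, to which the Weierstrass test applies. Subtracting the central values allows a
  limit before the convergence of the samples is known.\<close>

lemma uniform_limit_oscillation:
  obtains D where "continuous_on {- (p/2)..p/2} D" "D 0 = 0"
    "uniform_limit {- (p/2)..p/2}
      (\<lambda>M v. \<Sum>j\<in>{- int M..int M}. g (v + of_int j * p) - g (of_int j * p)) D sequentially"
proof -
  let ?I = "{- (p/2)..p/2}"
  obtain osc where osc: "\<And>j v. \<bar>v\<bar> \<le> p/2 \<Longrightarrow> cmod (g (v + of_int j * p) - g (of_int j * p)) \<le> osc j"
    "\<And>j. 0 \<le> osc j" "\<And>N. (\<Sum>j\<in>{- int N..int N}. osc j) \<le> V"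
    using summable_oscillation by metis
  define u where "u v j = g (v + of_int j * p) - g (of_int j * p)" for v j
  define B where "B i = osc (int (Suc i)) + osc (- int (Suc i))" for i
  define t where "t i v = u v (int (Suc i)) + u v (- int (Suc i))" for i v
  have "summable B"
  proof (rule summableI_nonneg_bounded)
    show "0 \<le> B i" for i using osc(2) by (simp add: B_def add_nonneg_nonneg)
    show "(\<Sum>i<n. B i) \<le> V" for n
      using osc(3)[of n] osc(2)[of 0] unfolding sum_symmetric_eq B_def by linarith
  qed
  moreover have "norm (t i v) \<le> B i" if "v \<in> ?I" for i v
  proof -
    have v: "\<bar>v\<bar> \<le> p/2" using that by auto
    show ?thesis unfolding t_def B_def u_def by (intro norm_triangle_le add_mono osc(1) v)
  qed
  ultimately have "uniform_limit ?I (\<lambda>n v. \<Sum>i<n. t i v) (\<lambda>v. \<Sum>i. t i v) sequentially"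
    by (intro Weierstrass_m_test)
  then have "uniform_limit ?I (\<lambda>M v. u v 0 + (\<Sum>i<M. t i v)) (\<lambda>v. u v 0 + (\<Sum>i. t i v)) sequentially"
    by (intro uniform_limit_add uniform_limit_const)
  moreover have "u v 0 + (\<Sum>i<M. t i v) = (\<Sum>j\<in>{- int M..int M}. u v j)" for M v
    unfolding t_def by (rule sum_symmetric_eq[symmetric])
  ultimately have ul: "uniform_limit ?I (\<lambda>M v. \<Sum>j\<in>{- int M..int M}. g (v + of_int j * p) - g (of_int j * p))
      (\<lambda>v. u v 0 + (\<Sum>i. t i v)) sequentially"
    by (simp add: u_def)
  show thesis
  proof (rule that[OF _ _ ul])
    show "continuous_on ?I (\<lambda>v. u v 0 + (\<Sum>i. t i v))"
      by (rule uniform_limit_theorem[OF _ ul])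
         (auto intro!: always_eventually continuous_intros)
    show "u 0 0 + (\<Sum>i. t i 0) = 0" by (simp add: u_def t_def)
  qed
qed

lemma uniform_limit_periodization:
  assumes lim: "(\<lambda>M. \<Sum>j\<in>{- int M..int M}. g (of_int j * p)) \<longlonglongrightarrow> S"
  obtains G where "continuous_on {- (p/2)..p/2} G" "G 0 = S"
    "uniform_limit {- (p/2)..p/2} (\<lambda>M v. \<Sum>j\<in>{- int M..int M}. g (v + of_int j * p)) G sequentially"
proof -
  let ?I = "{- (p/2)..p/2}"
  obtain D where D: "continuous_on ?I D" "D 0 = 0" "uniform_limit ?I
      (\<lambda>M v. \<Sum>j\<in>{- int M..int M}. g (v + of_int j * p) - g (of_int j * p)) D sequentially"
    by (rule uniform_limit_oscillation)
  have "uniform_limit ?I (\<lambda>M v. \<Sum>j\<in>{- int M..int M}. g (of_int j * p)) (\<lambda>v. S) sequentially"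
    using lim by (auto simp: uniform_limit_iff tendsto_iff)
  from uniform_limit_add[OF this D(3)]
  have "uniform_limit ?I (\<lambda>M v. \<Sum>j\<in>{- int M..int M}. g (v + of_int j * p)) (\<lambda>v. S + D v) sequentially"
    by (simp add: sum_subtractf)
  then show thesis using D by (intro that[of "\<lambda>v. S + D v"]) (auto intro!: continuous_intros)
qed

text \<open>The integral over \<open>2 * M + 1\<close> periods is the integral of the oscillation
  sum plus \<open>p\<close> times the sum of samples. The first two converge, hence so does the
  third.\<close>

lemma convergent_samples:
  assumes "(\<lambda>M. integral {- ((real M + 1/2) * p)..(real M + 1/2) * p} g) \<longlonglongrightarrow> L"
  obtains S where "(\<lambda>M. \<Sum>j\<in>{- int M..int M}. g (of_int j * p)) \<longlonglongrightarrow> S"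
proof -
  let ?I = "{- (p/2)..p/2}"
  let ?D = "\<lambda>M v. \<Sum>j\<in>{- int M..int M}. g (v + of_int j * p) - g (of_int j * p)"
  let ?s = "\<lambda>M. \<Sum>j\<in>{- int M..int M}. g (of_int j * p)"
  obtain D where D: "uniform_limit ?I ?D D sequentially"
    by (rule uniform_limit_oscillation)
  then obtain I J where IJ: "\<And>M. (?D M has_integral I M) ?I" "I \<longlonglongrightarrow> J"
    by (rule uniform_limit_integral) (auto intro!: continuous_intros)
  have "integral {- ((real M + 1/2) * p)..(real M + 1/2) * p} g - I M = of_real p * ?s M" for M
  proof -
    have "((\<lambda>v. ?s M) has_integral of_real p * ?s M) ?I"
      using has_integral_const_real[of "?s M" "- (p/2)" "p/2"] period_pos by (simp add: scaleR_conv_of_real)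
    from has_integral_add[OF IJ(1)[of M] this]
    have "integral ?I (\<lambda>v. \<Sum>j\<in>{- int M..int M}. g (v + of_int j * p)) = I M + of_real p * ?s M"
      by (simp add: sum_subtractf integral_unique)
    then show ?thesis unfolding integral_unfold_periods[OF cont period_pos] by simp
  qed
  with tendsto_diff[OF assms IJ(2)] have "(\<lambda>M. of_real p * ?s M) \<longlonglongrightarrow> L - J" by simp
  from tendsto_mult[OF tendsto_const[of "inverse (of_real p)"] this]
  have "?s \<longlonglongrightarrow> inverse (of_real p) * (L - J)"
    using period_pos by (simp add: field_simps)
  then show thesis by (rule that)
qed

end

section \<open>Cesaro means and the Tauberian theorem\<close>

text \<open>Hardy's theorem. The mean of \<open>s\<close> over a window from \<open>n\<close> of
  length about \<open>n / q\<close> is close to \<open>L\<close> by the Cesaro hypothesis, and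
  within the window \<open>s\<close> moves by at most \<open>C / q\<close>.\<close>

lemma tauberian_Cesaro:
  fixes s :: "nat \<Rightarrow> 'a::real_normed_field"
  assumes cesaro: "(\<lambda>N. (\<Sum>n<N. s n) / of_nat N) \<longlonglongrightarrow> L"
    and step: "\<And>n. norm (s (Suc n) - s n) \<le> C / real (Suc n)"
  shows "s \<longlonglongrightarrow> L"
proof (rule LIMSEQ_I)
  fix \<epsilon> :: real
  assume \<epsilon>: "\<epsilon> > 0"
  have C: "C \<ge> 0" using order_trans[OF norm_ge_zero step[of 0]] by simp
  obtain q :: nat where q: "2 * C / \<epsilon> < real q" using reals_Archimedean2 by blast
  have q0: "q > 0" using q C \<epsilon> by (cases "q = 0") (auto simp: divide_less_0_iff)
  define T where "T N = (\<Sum>n<N. s n - L)" for N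
  \<comment> \<open>The two sums \<open>T\<close> will contribute at most
    \<open>\<eta> * (2 * n + d)\<close>, which is at most \<open>\<eta> * 6 * q * d\<close>; the
    constant 12 makes this \<open>d * \<epsilon> / 2\<close>.\<close>
  define \<eta> where "\<eta> = \<epsilon> / (12 * real q)"
  have \<eta>: "\<eta> > 0" using \<epsilon> q0 by (simp add: \<eta>_def)
  obtain N0 where N0: "\<And>N. N \<ge> N0 \<Longrightarrow> norm ((\<Sum>n<N. s n) / of_nat N - L) < \<eta>"
    using LIMSEQ_D[OF cesaro \<eta>] by blast
  have T: "norm (T N) \<le> \<eta> * real N" if "N \<ge> N0" for N
  proof (cases "N = 0")
    case False
    have "T N = ((\<Sum>n<N. s n) / of_nat N - L) * of_nat N"
      using False by (simp add: T_def sum_subtractf field_simps)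
    then have "norm (T N) = norm ((\<Sum>n<N. s n) / of_nat N - L) * real N"
      by (simp only: norm_mult norm_of_nat)
    then show ?thesis using N0[OF that] by (simp add: mult_right_mono)
  qed (simp add: T_def)
  have var: "norm (s (n + i) - s n) \<le> real i * (C / real n)" if "n > 0" for n i
  proof (induction i)
    case (Suc i)
    have "norm (s (n + Suc i) - s n) \<le> norm (s (Suc (n + i)) - s (n + i)) + norm (s (n + i) - s n)"
      using norm_triangle_ineq[of "s (Suc (n + i)) - s (n + i)" "s (n + i) - s n"] by simp
    also have "\<dots> \<le> C / real (Suc (n + i)) + real i * (C / real n)"
      by (intro add_mono step Suc.IH)
    also have "\<dots> \<le> C / real n + real i * (C / real n)"
      using that C by (intro add_right_mono divide_left_mono) auto
    finally show ?case by (simp add: algebra_simps add_divide_distrib)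
  qed simp
  show "\<exists>no. \<forall>n\<ge>no. norm (s n - L) < \<epsilon>"
  proof (intro exI[of _ "max q N0"] allI impI)
    fix n
    assume n: "n \<ge> max q N0"
    \<comment> \<open>Since \<open>n \<ge> q\<close>, the window length is positive and comparable
      to \<open>n\<close>: \<open>n < q * (d + 1) \<le> 2 * q * d\<close>.\<close>
    define d where "d = n div q"
    have d0: "d > 0" using n q0 by (simp add: d_def div_greater_zero_iff)
    have dq: "d * q \<le> n" by (simp add: d_def)
    have "n < q * Suc d" using q0 by (simp add: d_def dividend_less_times_div)
    also have "\<dots> \<le> 2 * q * d" using d0 by simp
    finally have nd: "real n \<le> 2 * real q * real d"
      by (metis less_imp_le of_nat_le_iff of_nat_mult of_nat_numeral)
    have n0: "n > 0" using n q0 by simp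
    have dn: "real d \<le> real n" unfolding d_def by simp
    have sum: "T (n + d) = T n + (\<Sum>i<d. s (n + i) - L)"
      unfolding T_def by (induction d) (simp_all add: add.assoc)
    have "of_nat d * (s n - L) = T (n + d) - T n - (\<Sum>i<d. s (n + i) - s n)"
      unfolding sum by (simp add: sum_subtractf algebra_simps)
    then have "real d * norm (s n - L) = norm (T (n + d) - T n - (\<Sum>i<d. s (n + i) - s n))"
      by (metis norm_mult norm_of_nat)
    also have "\<dots> \<le> norm (T (n + d)) + norm (T n) + norm (\<Sum>i<d. s (n + i) - s n)"
      by (meson add_mono norm_triangle_ineq4 order_refl order_trans)
    also have "norm (\<Sum>i<d. s (n + i) - s n) \<le> (\<Sum>i<d. C / real q)"
    proof (intro sum_norm_le)
      fix i assume "i \<in> {..<d}"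
      then have "i * q \<le> n" using dq by (metis le_trans lessThan_iff less_imp_le mult_le_mono1)
      then have "real i * real q \<le> real n" by (metis of_nat_le_iff of_nat_mult)
      then have "real i * (C / real n) \<le> C / real q"
        using n0 q0 C by (simp add: field_simps) (metis mult.assoc mult.commute mult_right_mono)
      then show "norm (s (n + i) - s n) \<le> C / real q" using var[OF n0, of i] by linarith
    qed
    also have "norm (T (n + d)) \<le> \<eta> * real (n + d)" using n by (intro T) simp
    also have "norm (T n) \<le> \<eta> * real n" using n by (intro T) simp
    also have "\<eta> * real (n + d) + \<eta> * real n + (\<Sum>i<d. C / real q) \<le> \<eta> * (6 * real q * real d) + real d * (C / real q)"
    proof -
      have "\<eta> * (real (n + d) + real n) \<le> \<eta> * (6 * real q * real d)"
        using \<eta> dn nd by (intro mult_left_mono) auto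
      then show ?thesis by (simp add: distrib_left)
    qed
    also have "\<eta> * (6 * real q * real d) = real d * (\<epsilon> / 2)"
      using q0 by (simp add: \<eta>_def)
    finally have "real d * norm (s n - L) \<le> real d * (\<epsilon> / 2 + C / real q)"
      by (simp add: distrib_left)
    then have "norm (s n - L) \<le> \<epsilon> / 2 + C / real q" using d0 by simp
    moreover have "C / real q < \<epsilon> / 2" using q q0 \<epsilon> by (simp add: field_simps)
    ultimately show "norm (s n - L) < \<epsilon>" by linarith
  qed
qed

section \<open>Fejer means on a period interval\<close>

lemma has_integral_cis_multiple:
  assumes "p > 0"
  shows "((\<lambda>v. cis (of_int k * (2 * pi * v / p))) has_integral (if k = 0 then of_real p else 0)) {- (p/2)..p/2}"
proof (cases "k = 0")
  case True
  then show ?thesis using assms has_integral_const_real[of "1::complex" "- (p/2)" "p/2"]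
    by (simp add: scaleR_conv_of_real)
next
  case False
  have "((\<lambda>v. cis (of_int k * (2 * pi / p) * v)) has_integral 0) {- (p/2)..- (p/2) + p}"
    using assms False by (intro has_integral_cis_period) auto
  then show ?thesis using False by (simp add: mult.assoc)
qed

lemma integral_fejer_kernel_mult:
  fixes G :: "real \<Rightarrow> complex"
  assumes "p > 0" and "continuous_on {- (p/2)..p/2} G"
  shows "integral {- (p/2)..p/2} (\<lambda>v. of_real (fejer_kernel N (2 * pi * v / p)) * G v) =
    (\<Sum>n<N. \<Sum>k\<in>{- int n..int n}.
      integral {- (p/2)..p/2} (\<lambda>v. G v * cis (of_int k * (2 * pi * v / p)))) / of_nat N"
proof -
  have "(\<lambda>v. G v * cis (of_int k * (2 * pi * v / p))) integrable_on {- (p/2)..p/2}" for k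
    using assms(1) by (intro integrable_continuous_real continuous_intros assms(2)) auto
  then have "((\<lambda>v. (\<Sum>n<N. \<Sum>k\<in>{- int n..int n}. G v * cis (of_int k * (2 * pi * v / p))) / of_nat N)
    has_integral (\<Sum>n<N. \<Sum>k\<in>{- int n..int n}.
      integral {- (p/2)..p/2} (\<lambda>v. G v * cis (of_int k * (2 * pi * v / p)))) / of_nat N) {- (p/2)..p/2}"
    by (intro has_integral_divide has_integral_sum integrable_integral) auto
  then show ?thesis
    by (intro integral_unique) (simp add: of_real_fejer_kernel sum_distrib_left mult.commute)
qed

lemma has_integral_fejer_kernel:
  assumes "p > 0" and "N > 0"
  shows "((\<lambda>v. fejer_kernel N (2 * pi * v / p)) has_integral p) {- (p/2)..p/2}"
proof -
  have "((\<lambda>v. (\<Sum>n<N. \<Sum>k\<in>{- int n..int n}. cis (of_int k * (2 * pi * v / p))) / of_nat N)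
    has_integral (\<Sum>n<N. \<Sum>k\<in>{- int n..int n}. if k = 0 then of_real p else 0) / of_nat N) {- (p/2)..p/2}"
    using assms(1) by (intro has_integral_divide has_integral_sum has_integral_cis_multiple) auto
  then have "((\<lambda>v. complex_of_real (fejer_kernel N (2 * pi * v / p))) has_integral of_real p) {- (p/2)..p/2}"
    using assms(2) by (simp add: of_real_fejer_kernel)
  from has_integral_linear[OF this bounded_linear_Re] show ?thesis by (simp add: o_def)
qed

text \<open>The kernel is nonnegative with total mass \<open>p\<close>, and outside a neighbourhood
  of the origin it is O(1/N); continuity of \<open>G\<close> at 0 handles the neighbourhood.\<close>

lemma fejer_kernel_approximate_identity:
  fixes G :: "real \<Rightarrow> complex"
  assumes p: "p > 0" and G: "continuous_on {- (p/2)..p/2} G"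
  shows "(\<lambda>N. integral {- (p/2)..p/2} (\<lambda>v. of_real (fejer_kernel N (2 * pi * v / p)) * G v))
    \<longlonglongrightarrow> of_real p * G 0"
proof (rule LIMSEQ_I)
  fix \<epsilon> :: real
  assume \<epsilon>: "\<epsilon> > 0"
  let ?I = "{- (p/2)..p/2}"
  let ?K = "\<lambda>N v. fejer_kernel N (2 * pi * v / p)"
  define e where "e = \<epsilon> / (2 * p)"
  have e: "e > 0" using \<epsilon> p by (simp add: e_def)
  have K: "continuous_on ?I (?K N)" for N
    unfolding divide_inverse by (intro continuous_intros)
  obtain d0 where d0: "d0 > 0" "\<And>v. v \<in> ?I \<Longrightarrow> \<bar>v\<bar> < d0 \<Longrightarrow> cmod (G v - G 0) < e"
    using G[unfolded continuous_on_iff, rule_format, of 0, OF _ e] p by (auto simp: dist_norm)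
  \<comment> \<open>The cap \<open>p/2\<close> keeps \<open>pi * d / p\<close> within the range up
    to \<open>pi / 2\<close>, where the sine increases.\<close>
  define d where "d = min d0 (p/2)"
  have d: "d > 0" "d \<le> p/2" using d0 p by (auto simp: d_def)
  obtain B where B: "\<And>v. v \<in> ?I \<Longrightarrow> cmod (G v - G 0) \<le> B"
  proof -
    have "bounded ((\<lambda>v. G v - G 0) ` ?I)"
      by (intro compact_imp_bounded compact_continuous_image continuous_intros G) auto
    then obtain B where "\<forall>x\<in>?I. cmod (G x - G 0) \<le> B" by (auto simp: bounded_iff)
    then show thesis by (intro that) blast
  qed
  have B0: "B \<ge> 0" using B[of 0] p by auto
  define S where "S = (sin (pi * d / p))\<^sup>2"
  have pd: "0 < pi * d / p" "pi * d / p \<le> pi / 2"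
    using d p by (auto simp: field_simps)
  then have S: "S > 0" unfolding S_def using sin_gt_zero[of "pi * d / p"] pi_gt_zero
    by (smt (verit) field_sum_of_halves zero_less_power)
  \<comment> \<open>One majorant serves both regions: \<open>e\<close> suffices near 0, and
    elsewhere the squared sine is at least \<open>S\<close>. Against the kernel the squared sine
    costs only \<open>1 / N\<close>, so the integral need not be split.\<close>
  have bound: "cmod (G v - G 0) \<le> e + B / S * (sin (2 * pi * v / p / 2))\<^sup>2" if v: "v \<in> ?I" for v
  proof (cases "\<bar>v\<bar> < d")
    case True
    then have "cmod (G v - G 0) < e" using d0(2)[OF v] by (simp add: d_def)
    moreover have "0 \<le> B / S * (sin (2 * pi * v / p / 2))\<^sup>2" using B0 S by simp
    ultimately show ?thesis by linarith
  next
    case False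
    have "pi * d / p \<le> pi * \<bar>v\<bar> / p" using False p by (simp add: divide_right_mono)
    moreover have "pi * \<bar>v\<bar> / p \<le> pi / 2" using v p by (auto simp: field_simps abs_le_iff)
    ultimately have "sin (pi * d / p) \<le> sin (pi * \<bar>v\<bar> / p)"
      using pd by (intro sin_monotone_2pi_le) linarith+
    moreover have "0 \<le> sin (pi * d / p)" using pd by (intro sin_ge_zero) linarith+
    ultimately have "S \<le> (sin (pi * \<bar>v\<bar> / p))\<^sup>2" unfolding S_def by (rule power_mono)
    also have "\<dots> = (sin (2 * pi * v / p / 2))\<^sup>2" by (cases "v \<ge> 0") (auto simp: abs_if)
    finally have "B \<le> B / S * (sin (2 * pi * v / p / 2))\<^sup>2"
      using S B0 by (simp add: field_simps mult_left_mono)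
    then show ?thesis using B[OF v] e by linarith
  qed
  obtain N0 :: nat where N0: "2 * (B / S) * p / \<epsilon> < real N0" using reals_Archimedean2 by blast
  show "\<exists>no. \<forall>N\<ge>no. cmod (integral ?I (\<lambda>v. of_real (?K N v) * G v) - of_real p * G 0) < \<epsilon>"
  proof (intro exI[of _ "Suc N0"] allI impI)
    fix N assume N: "N \<ge> Suc N0"
    then have Npos: "N > 0" by simp
    have int: "((\<lambda>v. complex_of_real (?K N v) * G 0) has_integral of_real p * G 0) ?I"
      using has_integral_linear[OF has_integral_fejer_kernel[OF p Npos] bounded_linear_of_real]
      by (intro has_integral_mult_left) (simp add: o_def)
    let ?D = "\<lambda>v. of_real (?K N v) * G v - of_real (?K N v) * G 0"
    have "integral ?I ?D =
        integral ?I (\<lambda>v. of_real (?K N v) * G v) - integral ?I (\<lambda>v. of_real (?K N v) * G 0)"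
      by (intro integral_diff integrable_continuous_real continuous_intros G K)
    then have diff: "integral ?I (\<lambda>v. of_real (?K N v) * G v) - of_real p * G 0 = integral ?I ?D"
      by (simp only: integral_unique[OF int])
    have "cmod (integral ?I ?D) \<le> integral ?I (\<lambda>v. e * ?K N v + (B / S) * (1 / real N))"
    proof (rule integral_norm_bound_integral)
      fix v assume v: "v \<in> ?I"
      have "cmod (of_real (?K N v) * G v - of_real (?K N v) * G 0) = ?K N v * cmod (G v - G 0)"
        by (simp add: right_diff_distrib[symmetric] norm_mult fejer_kernel_nonneg)
      also have "\<dots> \<le> ?K N v * (e + B / S * (sin (2 * pi * v / p / 2))\<^sup>2)"
        by (intro mult_left_mono bound v fejer_kernel_nonneg)
      also have "\<dots> = e * ?K N v + B / S * (?K N v * (sin (2 * pi * v / p / 2))\<^sup>2)"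
        by (simp add: algebra_simps)
      also have "\<dots> \<le> e * ?K N v + B / S * (1 / real N)"
        using B0 S by (intro add_left_mono mult_left_mono fejer_kernel_sin_sq_le) auto
      finally show "cmod (of_real (?K N v) * G v - of_real (?K N v) * G 0) \<le> \<dots>" .
    qed (intro integrable_continuous_real continuous_intros G K)+
    moreover have "((\<lambda>v. x) has_integral x * p) ?I" for x :: real
      using has_integral_const_real[of x "- (p/2)" "p/2"] p by (simp add: mult.commute)
    from integral_unique[OF has_integral_add[OF has_integral_mult_right[OF
          has_integral_fejer_kernel[OF p Npos]] this]]
    have "integral ?I (\<lambda>v. e * ?K N v + (B / S) * (1 / real N)) = e * p + (B / S) * (1 / real N) * p" .
    moreover have "e * p = \<epsilon> / 2" using p by (simp add: e_def)
    moreover have "(B / S) * (1 / real N) * p < \<epsilon> / 2"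
    proof -
      have "2 * (B / S) * p / \<epsilon> < real N" using N0 N by linarith
      then have "(B / S * p) * 2 < \<epsilon> * real N"
        using pos_divide_less_eq[OF \<epsilon>, of "2 * (B / S) * p"] by (simp only: mult_ac)
      then have "(B / S * p) / real N < \<epsilon> / 2"
        using Npos by (subst pos_divide_less_eq) auto
      then show ?thesis by simp
    qed
    ultimately show "cmod (integral ?I (\<lambda>v. of_real (?K N v) * G v) - of_real p * G 0) < \<epsilon>"
      unfolding diff by linarith
  qed
qed

section \<open>Fourier coefficients of the periodization\<close>

context continuous_bv
begin

text \<open>The interval is cut into full periods of the character, each of length
  \<open>p / \<bar>k\<bar>\<close>. Each piece is at most an oscillation of \<open>g\<close> times
  this length, and the oscillations sum to at most \<open>V\<close>.\<close>

lemma norm_integral_cis_le: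
  assumes k: "k \<noteq> 0"
  shows "cmod (integral {a..a + real n * (p / \<bar>of_int k\<bar>)} (\<lambda>v. g v * cis (of_int k * (2 * pi * v / p))))
    \<le> p * V / \<bar>of_int k\<bar>"
proof -
  define l where "l = p / \<bar>of_int k\<bar>"
  have l: "l > 0" using k period_pos by (simp add: l_def)
  let ?e = "\<lambda>v. cis (of_int k * (2 * pi * v / p))"
  have int: "(\<lambda>v. u v * ?e v) integrable_on {c..d}" if "continuous_on {c..d} u" for u c d
    using period_pos by (intro integrable_continuous_real continuous_intros that) auto
  have zero: "(?e has_integral 0) {c..c + l}" for c
  proof -
    have "((\<lambda>v. cis (of_int k * (2 * pi / p) * v)) has_integral 0) {c..c + l}"
      using k period_pos l
      \<comment> \<open>Over this length the phase turns once, in the direction given by the sign of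
        \<open>k\<close>.\<close>
      by (intro has_integral_cis_period[of _ _ "if k > 0 then 1 else - 1"]) (auto simp: l_def abs_if)
    then show ?thesis by (simp add: mult.assoc)
  qed
  have "\<exists>w\<in>{c..c + l}. \<forall>v\<in>{c..c + l}. cmod (g v - g c) \<le> cmod (g w - g c)" for c
    using l by (intro continuous_attains_sup continuous_intros) auto
  then have "\<forall>c. \<exists>w. w \<in> {c..c + l} \<and> (\<forall>v\<in>{c..c + l}. cmod (g v - g c) \<le> cmod (g w - g c))"
    by blast
  then obtain w where w: "\<And>c. w c \<in> {c..c + l}"
    "\<And>c v. v \<in> {c..c + l} \<Longrightarrow> cmod (g v - g c) \<le> cmod (g (w c) - g c)"
    using choice[where Q = "\<lambda>c w. w \<in> {c..c + l} \<and> (\<forall>v\<in>{c..c + l}. cmod (g v - g c) \<le> cmod (g w - g c))"]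
    by blast
  \<comment> \<open>Over a full period of the character, g may be replaced by its deviation from a constant.\<close>
  have piece: "cmod (integral {c..c + l} (\<lambda>v. g v * ?e v)) \<le> cmod (g (w c) - g c) * l" for c
  proof -
    have const: "((\<lambda>v. g c * ?e v) has_integral 0) {c..c + l}"
      using has_integral_mult_right[OF zero] by simp
    have "integral {c..c + l} (\<lambda>v. g v * ?e v) =
        integral {c..c + l} (\<lambda>v. g v * ?e v) - integral {c..c + l} (\<lambda>v. g c * ?e v)"
      by (simp only: integral_unique[OF const] diff_zero)
    also have "\<dots> = integral {c..c + l} (\<lambda>v. g v * ?e v - g c * ?e v)"
      by (intro integral_diff[symmetric] int continuous_intros)
    also have "cmod \<dots> \<le> cmod (g (w c) - g c) * (c + l - c)"
    proof (rule integral_bound)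
      show "cmod (g t * ?e t - g c * ?e t) \<le> cmod (g (w c) - g c)" if "t \<in> {c..c + l}" for t
        using w(2)[OF that] by (simp add: left_diff_distrib[symmetric] norm_mult)
    qed (use l period_pos in \<open>auto intro!: continuous_intros\<close>)
    finally show ?thesis by simp
  qed
  have "cmod (integral {a..a + real n * l} (\<lambda>v. g v * ?e v)) \<le>
      (\<Sum>i<n. cmod (g (w (a + real i * l)) - g (a + real i * l)) * l)"
  proof (induction n)
    case (Suc n)
    have "a + real (Suc n) * l = (a + real n * l) + l" by (simp add: algebra_simps)
    then have "integral {a..a + real (Suc n) * l} (\<lambda>v. g v * ?e v) =
        integral {a..a + real n * l} (\<lambda>v. g v * ?e v) +
        integral {a + real n * l..(a + real n * l) + l} (\<lambda>v. g v * ?e v)"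
      using l by (simp only:) (intro Henstock_Kurzweil_Integration.integral_combine[symmetric] int
        continuous_intros, auto)
    then show ?case
      using norm_triangle_mono[OF Suc.IH piece[of "a + real n * l"]] by simp
  qed simp
  also have "\<dots> = (\<Sum>i<n. cmod (g (w (a + real i * l)) - g (a + real i * l))) * l"
    by (simp add: sum_distrib_right)
  also have "\<dots> \<le> V * l"
  proof (intro mult_right_mono sum_variation_intervals_le[OF var])
    show "a + real i * l \<le> w (a + real i * l)" "w (a + real i * l) \<le> a + real (Suc i) * l" for i
      using w(1)[of "a + real i * l"] by (auto simp: algebra_simps)
  qed (use l in auto)
  finally show ?thesis by (simp add: l_def mult.commute)
qed

text \<open>The character has period \<open>p\<close> in \<open>v\<close>, so the integral over
  \<open>2 * M + 1\<close> periods folds onto the base interval, where uniform convergence allows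
  passing to the limit under the integral.\<close>

lemma coefficients_tendsto:
  assumes G: "continuous_on {- (p/2)..p/2} G"
    "uniform_limit {- (p/2)..p/2} (\<lambda>M v. \<Sum>j\<in>{- int M..int M}. g (v + of_int j * p)) G sequentially"
  shows "(\<lambda>M. integral {- ((real M + 1/2) * p)..(real M + 1/2) * p}
        (\<lambda>v. g v * cis (of_int k * (2 * pi * v / p)))) \<longlonglongrightarrow>
    integral {- (p/2)..p/2} (\<lambda>v. G v * cis (of_int k * (2 * pi * v / p)))"
proof -
  let ?I = "{- (p/2)..p/2}"
  let ?e = "\<lambda>v. cis (of_int k * (2 * pi * v / p))"
  have periodic: "?e (v + of_int j * p) = ?e v" for v j
  proof -
    have "of_int k * (2 * pi * (v + of_int j * p) / p) =
        of_int k * (2 * pi * v / p) + 2 * pi * of_int (k * j)"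
      using period_pos by (simp add: field_simps)
    then show ?thesis by (simp add: cis_mult[symmetric])
  qed
  have unfold: "integral {- ((real M + 1/2) * p)..(real M + 1/2) * p} (\<lambda>v. g v * ?e v) =
      integral ?I (\<lambda>v. (\<Sum>j\<in>{- int M..int M}. g (v + of_int j * p)) * ?e v)" for M
    using period_pos
    by (subst integral_unfold_periods)
       (auto intro!: continuous_intros simp only: periodic sum_distrib_right)
  have "uniform_limit ?I (\<lambda>M v. (\<Sum>j\<in>{- int M..int M}. g (v + of_int j * p)) * ?e v)
      (\<lambda>v. G v * ?e v) sequentially"
    using G(2) by (rule uniform_lim_mult[OF _ uniform_limit_const])
      (auto intro!: compact_imp_bounded compact_continuous_image continuous_intros G(1)
        simp: period_pos less_imp_neq[symmetric])
  then obtain I J where IJ: "\<And>M. ((\<lambda>v. (\<Sum>j\<in>{- int M..int M}. g (v + of_int j * p)) * ?e v) has_integral I M) ?I"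
    "((\<lambda>v. G v * ?e v) has_integral J) ?I" "I \<longlonglongrightarrow> J"
    by (rule uniform_limit_integral)
      (use period_pos in \<open>auto intro!: continuous_intros\<close>)
  show ?thesis
    by (simp only: trans[OF unfold integral_unique[OF IJ(1)]] integral_unique[OF IJ(2)] IJ(3))
qed

text \<open>In classical terms, the Dirichlet--Jordan theorem at the origin for the periodization of g.\<close>

theorem symmetric_sum_coefficients_tendsto:
  assumes S: "(\<lambda>M. \<Sum>j\<in>{- int M..int M}. g (of_int j * p)) \<longlonglongrightarrow> S"
    and c: "\<And>k. (\<lambda>M. integral {- ((real M + 1/2) * p)..(real M + 1/2) * p}
        (\<lambda>v. g v * cis (of_int k * (2 * pi * v / p)))) \<longlonglongrightarrow> c k"
  shows "(\<lambda>N. \<Sum>k\<in>{- int N..int N}. c k) \<longlonglongrightarrow> of_real p * S"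
proof -
  let ?I = "{- (p/2)..p/2}"
  let ?e = "\<lambda>k v. cis (of_int k * (2 * pi * v / p))"
  obtain G where G: "continuous_on ?I G" "G 0 = S"
    "uniform_limit ?I (\<lambda>M v. \<Sum>j\<in>{- int M..int M}. g (v + of_int j * p)) G sequentially"
    by (rule uniform_limit_periodization[OF S])
  have c_eq: "c k = integral ?I (\<lambda>v. G v * ?e k v)" for k
    by (rule LIMSEQ_unique[OF c coefficients_tendsto[OF G(1,3)]])
  have bound: "cmod (c k) \<le> p * V / \<bar>of_int k\<bar>" if k: "k \<noteq> 0" for k
  proof (rule tendsto_upperbound[OF tendsto_norm[OF c]])
    \<comment> \<open>The interval is filled exactly by \<open>(2 * M + 1) * \<bar>k\<bar>\<close>
      periods of the character. The bound thus holds for every \<open>M\<close> and passes to the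
      limit \<open>c k\<close>.\<close>
    have period: "- ((real M + 1/2) * p) + real ((2 * M + 1) * nat \<bar>k\<bar>) * (p / \<bar>of_int k\<bar>) =
        (real M + 1/2) * p" for M
      using k by (simp add: field_simps)
    have "cmod (integral {- ((real M + 1/2) * p)..(real M + 1/2) * p} (\<lambda>v. g v * ?e k v))
        \<le> p * V / \<bar>of_int k\<bar>" for M
      using norm_integral_cis_le[OF k, of "- ((real M + 1/2) * p)" "(2 * M + 1) * nat \<bar>k\<bar>"]
      unfolding period .
    then show "\<forall>\<^sub>F M in sequentially. cmod (integral {- ((real M + 1/2) * p)..(real M + 1/2) * p}
        (\<lambda>v. g v * ?e k v)) \<le> p * V / \<bar>of_int k\<bar>"
      by simp
  qed simp
  show ?thesis
  proof (rule tauberian_Cesaro)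
    show "(\<lambda>N. (\<Sum>n<N. \<Sum>k\<in>{- int n..int n}. c k) / of_nat N) \<longlonglongrightarrow> of_real p * S"
      using fejer_kernel_approximate_identity[OF period_pos G(1)]
      unfolding integral_fejer_kernel_mult[OF period_pos G(1)] c_eq[symmetric] G(2) .
    fix n
    have "cmod ((\<Sum>k\<in>{- int (Suc n)..int (Suc n)}. c k) - (\<Sum>k\<in>{- int n..int n}. c k)) =
        cmod (c (int (Suc n)) + c (- int (Suc n)))"
      by (simp only: sum_symmetric_Suc add_diff_cancel_left')
    also have "\<dots> \<le> p * V / real (Suc n) + p * V / real (Suc n)"
      using bound[of "int (Suc n)"] bound[of "- int (Suc n)"] by (intro norm_triangle_mono) (auto simp: add.commute)
    finally show "cmod ((\<Sum>k\<in>{- int (Suc n)..int (Suc n)}. c k) - (\<Sum>k\<in>{- int n..int n}. c k))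
        \<le> 2 * (p * V) / real (Suc n)"
      by (simp only: mult_2 add_divide_distrib)
  qed
qed

end

section \<open>The Fourier transform\<close>

text \<open>Serves to identify a limit: principal-value integrals already known to converge must
  agree with their Cesaro value from Fourier inversion.\<close>

lemma Cesaro_tendsto:
  fixes s :: "nat \<Rightarrow> 'a::real_normed_field"
  assumes "s \<longlonglongrightarrow> L"
  shows "(\<lambda>N. (\<Sum>n<N. s n) / of_nat N) \<longlonglongrightarrow> L"
proof (rule LIMSEQ_I)
  fix \<epsilon> :: real
  assume \<epsilon>: "\<epsilon> > 0"
  then obtain N0 where N0: "\<And>n. n \<ge> N0 \<Longrightarrow> norm (s n - L) < \<epsilon> / 2"
    using LIMSEQ_D[OF assms, of "\<epsilon> / 2"] by auto
  define K where "K = (\<Sum>n<N0. norm (s n - L))"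
  obtain N1 :: nat where N1: "2 * K / \<epsilon> < real N1" using reals_Archimedean2 by blast
  show "\<exists>no. \<forall>N\<ge>no. norm ((\<Sum>n<N. s n) / of_nat N - L) < \<epsilon>"
  proof (intro exI[of _ "Suc N1"] allI impI)
    fix N assume N: "N \<ge> Suc N1"
    have "norm (\<Sum>n<N. s n - L) \<le> (\<Sum>n<N. norm (s n - L))" by (rule norm_sum)
    also have "\<dots> \<le> (\<Sum>n<N. (if n < N0 then norm (s n - L) else 0) + \<epsilon> / 2)"
      using N0 \<epsilon> by (intro sum_mono) (auto simp: not_less intro: less_imp_le)
    also have "\<dots> \<le> K + real N * (\<epsilon> / 2)"
      by (auto simp: sum.distrib K_def sum.If_cases intro!: sum_mono2)
    also have "\<dots> < real N * \<epsilon>"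
    proof -
      have "2 * K / \<epsilon> < real N" using N1 N by linarith
      then show ?thesis using \<epsilon> by (simp add: pos_divide_less_eq)
    qed
    finally have "norm (\<Sum>n<N. s n - L) < real N * \<epsilon>" .
    moreover have "(\<Sum>n<N. s n) / of_nat N - L = (\<Sum>n<N. s n - L) / of_nat N"
      using N by (simp add: sum_subtractf field_simps)
    ultimately show "norm ((\<Sum>n<N. s n) / of_nat N - L) < \<epsilon>"
      using N by (simp add: norm_divide pos_divide_less_eq mult.commute)
  qed
qed

text \<open>Without the factor \<open>1 / sqrt (2 * pi)\<close> the value at 0 is the integral of
  \<open>f\<close>, and Poisson summation has \<open>h\<close> as its only constant.\<close>

definition unnormalized_fourier :: "(real \<Rightarrow> complex) \<Rightarrow> real \<Rightarrow> complex" where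
  "unnormalized_fourier f v = (LINT u|lborel. f u * cis (- (u * v)))"

lemma fourier_transform_eq: "fourier_transform f v = unnormalized_fourier f v / of_real (sqrt (2 * pi))"
  by (simp add: fourier_transform_def unnormalized_fourier_def cis_conv_exp)

lemma measurable_cis [measurable]: "cis \<in> borel_measurable borel"
  by (intro borel_measurable_continuous_onI continuous_intros)

lemma integrable_mult_cis:
  fixes f :: "real \<Rightarrow> complex"
  assumes "integrable lborel f" and [measurable]: "w \<in> borel_measurable borel"
  shows "integrable lborel (\<lambda>u. f u * cis (w u))"
proof (rule Bochner_Integration.integrable_bound[OF assms(1)])
  show "(\<lambda>u. f u * cis (w u)) \<in> borel_measurable lborel"
    using borel_measurable_integrable[OF assms(1)] by measurable
qed (simp add: norm_mult)

lemma continuous_on_unnormalized_fourier: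
  assumes f: "integrable lborel f"
  shows "continuous_on UNIV (unnormalized_fourier f)"
proof -
  note [measurable] = borel_measurable_integrable[OF f]
  have "(\<lambda>n. unnormalized_fourier f (x n)) \<longlonglongrightarrow> unnormalized_fourier f v" if "x \<longlonglongrightarrow> v" for x v
    unfolding unnormalized_fourier_def
  proof (rule integral_dominated_convergence)
    show "integrable lborel (\<lambda>u. cmod (f u))" using f by simp
    show "AE u in lborel. (\<lambda>n. f u * cis (- (u * x n))) \<longlonglongrightarrow> f u * cis (- (u * v))"
      unfolding cis_conv_exp by (intro AE_I2 tendsto_intros that)
  qed (simp_all add: norm_mult)
  then show ?thesis
    by (simp add: continuous_on_sequentially o_def)
qed

lemma unnormalized_fourier_shift:
  "(LINT x|lborel. f (x + c) * cis (- (x * v))) = cis (c * v) * unnormalized_fourier f v"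
proof -
  have "unnormalized_fourier f v = (LINT x|lborel. f (c + 1 * x) * cis (- ((c + 1 * x) * v)))"
    unfolding unnormalized_fourier_def
    using lborel_integral_real_affine[of 1 "\<lambda>u. f u * cis (- (u * v))" c] by simp
  also have "\<dots> = (LINT x|lborel. cis (- (c * v)) * (f (x + c) * cis (- (x * v))))"
    by (intro Bochner_Integration.integral_cong) (auto simp: cis_mult algebra_simps)
  also have "\<dots> = cis (- (c * v)) * (LINT x|lborel. f (x + c) * cis (- (x * v)))"
    by (rule integral_mult_right_zero)
  finally show ?thesis by (simp add: mult.assoc[symmetric] cis_mult)
qed

section \<open>Differences and the modulus of smoothness\<close>

lemma integrable_shift:
  fixes f :: "real \<Rightarrow> complex"
  shows "integrable lborel f \<Longrightarrow> integrable lborel (\<lambda>x. f (x + c))"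
  using lborel_integrable_real_affine[of f 1 c] by (simp add: add.commute)

lemma integrable_forward_difference:
  "integrable lborel f \<Longrightarrow> integrable lborel (forward_difference r h f)"
  unfolding forward_difference_def[abs_def]
  by (intro Bochner_Integration.integrable_sum integrable_mult_right integrable_shift)

text \<open>A translation by \<open>j * h\<close> multiplies the transform by
  \<open>cis (h * v) ^ j\<close>, and the binomial theorem collects these factors.\<close>

lemma unnormalized_fourier_forward_difference:
  assumes f: "integrable lborel f"
  shows "unnormalized_fourier (forward_difference r h f) v = (cis (h * v) - 1) ^ r * unnormalized_fourier f v"
proof -
  let ?c = "\<lambda>j. (- 1) ^ (r - j) * of_nat (r choose j) :: complex"
  have "unnormalized_fourier (forward_difference r h f) v =
      (LINT x|lborel. (\<Sum>j\<le>r. ?c j * (f (x + real j * h) * cis (- (x * v)))))"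
    unfolding unnormalized_fourier_def forward_difference_def
    by (simp add: sum_distrib_right mult.assoc)
  also have "\<dots> = (\<Sum>j\<le>r. (LINT x|lborel. ?c j * (f (x + real j * h) * cis (- (x * v)))))"
    by (intro Bochner_Integration.integral_sum integrable_mult_right integrable_mult_cis integrable_shift f) measurable
  also have "\<dots> = (\<Sum>j\<le>r. ?c j * (cis (real j * h * v) * unnormalized_fourier f v))"
    by (simp only: integral_mult_right_zero unnormalized_fourier_shift)
  also have "\<dots> = (\<Sum>j\<le>r. of_nat (r choose j) * cis (h * v) ^ j * (- 1) ^ (r - j)) * unnormalized_fourier f v"
    by (simp add: sum_distrib_left sum_distrib_right Complex.DeMoivre mult_ac)
  also have "\<dots> = (cis (h * v) + - 1) ^ r * unnormalized_fourier f v"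
    by (simp only: binomial_ring)
  finally show ?thesis by simp
qed

lemma unnormalized_fourier_le_modulus:
  assumes f: "integrable lborel f" and v: "v \<noteq> 0"
  shows "ennreal (2 ^ r * cmod (unnormalized_fourier f v)) \<le> modulus_of_smoothness_L1 r f (pi / \<bar>v\<bar>)"
proof -
  \<comment> \<open>The step makes \<open>cis (h * v) - 1\<close> equal to -2. It is negative for
    negative \<open>v\<close>, which the modulus admits since it ranges over steps of both
    signs.\<close>
  let ?h = "pi / v"
  have "2 ^ r * cmod (unnormalized_fourier f v) = cmod (unnormalized_fourier (forward_difference r ?h f) v)"
    using v by (simp add: unnormalized_fourier_forward_difference[OF f] norm_mult norm_power)
  also have "ennreal \<dots> \<le> (\<integral>\<^sup>+ x. cmod (forward_difference r ?h f x * cis (- (x * v))) \<partial>lborel)"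
    unfolding unnormalized_fourier_def
    by (intro integral_norm_bound_ennreal integrable_mult_cis integrable_forward_difference f) measurable
  also have "\<dots> = (\<integral>\<^sup>+ x. cmod (forward_difference r ?h f x) \<partial>lborel)"
    by (simp add: norm_mult)
  also have "\<dots> \<le> modulus_of_smoothness_L1 r f (pi / \<bar>v\<bar>)"
    unfolding modulus_of_smoothness_L1_def by (rule SUP_upper) (simp add: abs_divide)
  finally show ?thesis .
qed

section \<open>Integrals over expanding symmetric intervals\<close>

lemma integral_Icc_eq_lborel:
  fixes f :: "real \<Rightarrow> complex"
  assumes "continuous_on {a..b} f"
  shows "integral {a..b} f = (LINT x|lborel. indicator {a..b} x *\<^sub>R f x)"
  using set_borel_integral_eq_integral(2)[OF borel_integrable_atLeastAtMost'[OF assms]]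
  by (simp add: set_lebesgue_integral_def)

lemma integral_symmetric_tendsto:
  fixes f :: "real \<Rightarrow> complex"
  assumes f: "integrable lborel f" "continuous_on UNIV f" and p: "p > 0"
  shows "(\<lambda>M. integral {- ((real M + 1/2) * p)..(real M + 1/2) * p} f) \<longlonglongrightarrow> (LINT x|lborel. f x)"
proof -
  note [measurable] = borel_measurable_integrable[OF f(1)]
  have "(\<lambda>M. LINT x|lborel. indicator {- ((real M + 1/2) * p)..(real M + 1/2) * p} x *\<^sub>R f x)
      \<longlonglongrightarrow> (LINT x|lborel. f x)"
  proof (rule integral_dominated_convergence)
    show "AE x in lborel. (\<lambda>M. indicator {- ((real M + 1/2) * p)..(real M + 1/2) * p} x *\<^sub>R f x) \<longlonglongrightarrow> f x"
    proof (intro AE_I2 tendsto_eventually)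
      fix x :: real
      obtain M0 :: nat where M0: "\<bar>x\<bar> / p < real M0" using reals_Archimedean2 by blast
      have "x \<in> {- ((real M + 1/2) * p)..(real M + 1/2) * p}" if "M \<ge> M0" for M
      proof -
        have "\<bar>x\<bar> / p < real M + 1/2" using M0 that by linarith
        then have "\<bar>x\<bar> < (real M + 1/2) * p" using p by (simp only: pos_divide_less_eq)
        then show ?thesis by auto
      qed
      then show "\<forall>\<^sub>F M in sequentially.
          indicator {- ((real M + 1/2) * p)..(real M + 1/2) * p} x *\<^sub>R f x = f x"
        by (auto simp: eventually_sequentially intro!: exI[of _ M0])
    qed
    show "integrable lborel (\<lambda>x. cmod (f x))" using f by simp
  qed (auto simp: indicator_def)
  then show ?thesis
    using continuous_on_subset[OF f(2)] by (simp add: integral_Icc_eq_lborel)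
qed

section \<open>Fourier inversion in the Cesaro sense\<close>

lemma integrable_mult_bounded_continuous:
  fixes f w :: "real \<Rightarrow> complex"
  assumes f: "integrable lborel f" and w: "continuous_on UNIV w" "\<And>u. cmod (w u) \<le> B"
  shows "integrable lborel (\<lambda>u. f u * w u)"
proof (rule Bochner_Integration.integrable_bound)
  show "integrable lborel (\<lambda>u. B * cmod (f u))" using f by simp
  show "(\<lambda>u. f u * w u) \<in> borel_measurable lborel"
    using borel_measurable_integrable[OF f] borel_measurable_continuous_onI[OF w(1)] by measurable
  have "cmod (f u * w u) \<le> norm (B * cmod (f u))" for u
    using mult_right_mono[OF w(2), of "cmod (f u)" u] by (simp add: norm_mult mult.commute)
  then show "AE u in lborel. cmod (f u * w u) \<le> norm (B * cmod (f u))" by simp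
qed

text \<open>Fubini's theorem applies because the double integrand has modulus
  \<open>cmod (f u)\<close> on a strip of finite width. The truncated inversion integral becomes a
  convolution.\<close>

lemma integral_fourier_swap:
  assumes f: "integrable lborel f"
  shows "integral {a..b} (\<lambda>v. unnormalized_fourier f v * cis (x * v)) =
    (LINT u|lborel. f u * integral {a..b} (\<lambda>v. cis ((x - u) * v)))"
proof -
  note [measurable] = borel_measurable_integrable[OF f]
  let ?h = "\<lambda>u v. indicator {a..b} v *\<^sub>R (f u * cis ((x - u) * v))"
  have "integrable (lborel \<Otimes>\<^sub>M lborel) (\<lambda>(u, v). ?h u v)"
  proof (rule lborel_pair.Fubini_integrable)
    have "(LINT v|lborel. norm (case (u, v) of (u, v) \<Rightarrow> ?h u v)) = measure lborel {a..b} * cmod (f u)" for u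
      by (simp add: norm_mult)
    then show "integrable lborel (\<lambda>u. LINT v|lborel. norm (case (u, v) of (u, v) \<Rightarrow> ?h u v))"
      using f by simp
    show "AE u in lborel. integrable lborel (\<lambda>v. case (u, v) of (u, v) \<Rightarrow> ?h u v)"
      unfolding prod.case
      by (intro AE_I2 borel_integrable_atLeastAtMost'[unfolded set_integrable_def] continuous_intros)
  qed measurable
  from lborel_pair.Fubini_integral[OF this]
  have swap: "(LINT v|lborel. (LINT u|lborel. ?h u v)) = (LINT u|lborel. (LINT v|lborel. ?h u v))" .
  have "continuous_on S (\<lambda>v. unnormalized_fourier f v * cis (x * v))" for S
    by (intro continuous_intros continuous_on_subset[OF continuous_on_unnormalized_fourier[OF f]]) auto
  then have "integral {a..b} (\<lambda>v. unnormalized_fourier f v * cis (x * v)) =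
      (LINT v|lborel. indicator {a..b} v *\<^sub>R (unnormalized_fourier f v * cis (x * v)))"
    by (rule integral_Icc_eq_lborel)
  also have "\<dots> = (LINT v|lborel. (LINT u|lborel. ?h u v))"
  proof (intro Bochner_Integration.integral_cong refl)
    fix v
    have "unnormalized_fourier f v * cis (x * v) = (LINT u|lborel. f u * cis (- (u * v)) * cis (x * v))"
      unfolding unnormalized_fourier_def by (rule integral_mult_left_zero[symmetric])
    also have "\<dots> = (LINT u|lborel. f u * cis ((x - u) * v))"
      by (simp add: mult.assoc cis_mult left_diff_distrib)
    finally show "indicator {a..b} v *\<^sub>R (unnormalized_fourier f v * cis (x * v)) = (LINT u|lborel. ?h u v)"
      by (simp only: integral_scaleR_right)
  qed
  also note swap
  also have "(LINT u|lborel. (LINT v|lborel. ?h u v)) =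
      (LINT u|lborel. f u * integral {a..b} (\<lambda>v. cis ((x - u) * v)))"
  proof (intro Bochner_Integration.integral_cong refl)
    fix u
    have "(LINT v|lborel. ?h u v) = (LINT v|lborel. f u * (indicator {a..b} v *\<^sub>R cis ((x - u) * v)))"
      by (simp add: scaleR_conv_of_real mult_ac)
    also have "\<dots> = f u * (LINT v|lborel. indicator {a..b} v *\<^sub>R cis ((x - u) * v))"
      by (rule integral_mult_right_zero)
    also have "\<dots> = f u * integral {a..b} (\<lambda>v. cis ((x - u) * v))"
      by (subst integral_Icc_eq_lborel) (auto intro!: continuous_intros)
    finally show "(LINT v|lborel. ?h u v) = f u * integral {a..b} (\<lambda>v. cis ((x - u) * v))" .
  qed
  finally show ?thesis .
qed

lemma continuous_on_integral_cis:
  "continuous_on UNIV (\<lambda>y. integral {a..b} (\<lambda>v. cis (y * v)))"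
proof -
  have "continuous_on (UNIV \<times> cbox a b) (\<lambda>(y, v). cis (y * v))"
    unfolding case_prod_unfold by (intro continuous_intros)
  from integral_continuous_on_param[OF this] show ?thesis by simp
qed

lemma norm_integral_cis:
  assumes "a \<le> b"
  shows "cmod (integral {a..b} (\<lambda>v. cis (y * v))) \<le> b - a"
proof -
  have "continuous_on {a..b} (\<lambda>v. cis (y * v))" by (intro continuous_intros)
  from integral_bound[OF assms this, of 1] show ?thesis by simp
qed

text \<open>For half-integer cutoffs the continuous Dirichlet kernel is the periodic one times the
  integral over a single window. Averaging over \<open>M\<close> therefore produces the periodic
  Fejer kernel.\<close>

lemma integral_cis_unfold:
  assumes "s > 0"
  shows "integral {- ((real M + 1/2) * s)..(real M + 1/2) * s} (\<lambda>v. cis (y * v)) =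
    (\<Sum>j\<in>{- int M..int M}. cis (of_int j * (s * y))) * integral {- (s/2)..s/2} (\<lambda>v. cis (y * v))"
proof -
  have eq: "cis (y * (v + of_int j * s)) = cis (of_int j * (s * y)) * cis (y * v)" for v and j :: int
    by (simp add: cis_mult algebra_simps)
  have "integral {- ((real M + 1/2) * s)..(real M + 1/2) * s} (\<lambda>v. cis (y * v)) =
      integral {- (s/2)..s/2} (\<lambda>v. \<Sum>j\<in>{- int M..int M}. cis (y * (v + of_int j * s)))"
    by (intro integral_unfold_periods assms continuous_intros)
  then show ?thesis by (simp only: eq sum_distrib_right[symmetric] integral_mult_right)
qed

text \<open>The window integral is \<open>2 * sin (s * y / 2) / y\<close> for nonzero
  \<open>y\<close>. This form yields both its decay and its zeros at the nonzero multiples of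
  \<open>2 * pi / s\<close>.\<close>

lemma norm_integral_cis_symmetric:
  assumes "s > 0"
  shows "cmod (integral {- (s/2)..s/2} (\<lambda>v. cis (y * v))) * \<bar>y\<bar> = (if y = 0 then 0 else 2 * \<bar>sin (s * y / 2)\<bar>)"
proof (cases "y = 0")
  case False
  have "cis a - cis (- a) = 2 * \<i> * sin a" for a
    by (simp add: complex_eq_iff)
  then have "cis (y * (s/2)) - cis (y * - (s/2)) = 2 * \<i> * sin (s * y / 2)"
    by (simp add: mult.commute)
  moreover have "integral {- (s/2)..s/2} (\<lambda>v. cis (y * v)) = (cis (y * (s/2)) - cis (y * - (s/2))) / (\<i> * y)"
    using False assms by (intro integral_unique has_integral_cis) auto
  ultimately show ?thesis using False by (simp add: norm_divide norm_mult)
qed simp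

lemma Cesaro_integral_fourier:
  assumes f: "integrable lborel f" and s: "s > 0"
  shows "(\<Sum>m<N. integral {- ((real m + 1/2) * s)..(real m + 1/2) * s}
        (\<lambda>v. unnormalized_fourier f v * cis (x * v))) / of_nat N =
    (LINT y|lborel. f (x - y) * (of_real (fejer_kernel N (s * y)) * integral {- (s/2)..s/2} (\<lambda>v. cis (y * v))))"
proof -
  let ?J = "\<lambda>m y. integral {- ((real m + 1/2) * s)..(real m + 1/2) * s} (\<lambda>v. cis (y * v))"
  have int: "integrable lborel (\<lambda>u. f u * ?J m (x - u))" for m
  proof (rule integrable_mult_bounded_continuous[OF f])
    show "continuous_on UNIV (\<lambda>u. ?J m (x - u))"
      by (rule continuous_on_compose2[OF continuous_on_integral_cis]) (auto intro!: continuous_intros)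
    show "cmod (?J m (x - u)) \<le> (real m + 1/2) * s - - ((real m + 1/2) * s)" for u
      using s by (intro norm_integral_cis) auto
  qed
  have kernel: "(\<Sum>m<N. f u * ?J m (x - u)) / of_nat N = f u * (of_real (fejer_kernel N (s * (x - u))) *
      integral {- (s/2)..s/2} (\<lambda>v. cis ((x - u) * v)))" for u
    unfolding integral_cis_unfold[OF s] of_real_fejer_kernel
    by (simp only: sum_distrib_left[symmetric] sum_distrib_right[symmetric] times_divide_eq_left times_divide_eq_right)
  have "(\<Sum>m<N. integral {- ((real m + 1/2) * s)..(real m + 1/2) * s}
        (\<lambda>v. unnormalized_fourier f v * cis (x * v))) / of_nat N =
      (LINT u|lborel. (\<Sum>m<N. f u * ?J m (x - u)) / of_nat N)"
    by (simp add: integral_fourier_swap[OF f] Bochner_Integration.integral_sum int)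
  also have "\<dots> = (LINT u|lborel. f u * (of_real (fejer_kernel N (s * (x - u))) *
      integral {- (s/2)..s/2} (\<lambda>v. cis ((x - u) * v))))"
    by (simp only: kernel)
  also have "\<dots> = (LINT y|lborel. f (x + - 1 * y) * (of_real (fejer_kernel N (s * (x - (x + - 1 * y)))) *
      integral {- (s/2)..s/2} (\<lambda>v. cis ((x - (x + - 1 * y)) * v))))"
    by (subst lborel_integral_real_affine[of "- 1" _ x]) auto
  finally show ?thesis by simp
qed

text \<open>On one period around 0 the Fejer kernel acts as an approximate identity; there
  \<open>?E 0 = s\<close> and \<open>p * s = 2 * pi\<close> produce the constant. The rest of the
  line contributes 0 by dominated convergence.\<close>

lemma fourier_inversion_Cesaro:
  fixes f :: "real \<Rightarrow> complex"
  assumes f: "integrable lborel f" "continuous_on UNIV f" and s: "s > 0"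
  shows "(\<lambda>N. (\<Sum>m<N. integral {- ((real m + 1/2) * s)..(real m + 1/2) * s}
        (\<lambda>v. unnormalized_fourier f v * cis (x * v))) / of_nat N) \<longlonglongrightarrow> 2 * pi * f x"
proof -
  define p where "p = 2 * pi / s"
  have p: "p > 0" "s = 2 * pi / p" using s by (auto simp: p_def)
  let ?I = "{- (p/2)..p/2}"
  let ?E = "\<lambda>y. integral {- (s/2)..s/2} (\<lambda>v. cis (y * v))"
  define \<phi> where "\<phi> N y = f (x - y) * (of_real (fejer_kernel N (s * y)) * ?E y)" for N y
  have fx: "integrable lborel (\<lambda>y. f (x - y))"
    using lborel_integrable_real_affine[OF f(1), of "- 1" x] by simp
  have cont_f: "continuous_on S (\<lambda>y. f (x - y))" for S
    by (rule continuous_on_compose2[OF f(2)]) (auto intro!: continuous_intros)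
  have cont_E: "continuous_on S ?E" for S
    by (rule continuous_on_subset[OF continuous_on_integral_cis]) auto
  have cont_\<phi>: "continuous_on S (\<phi> N)" for S N
    unfolding \<phi>_def[abs_def] by (intro continuous_intros cont_f cont_E)
  have [measurable]: "\<phi> N \<in> borel_measurable borel" for N
    by (intro borel_measurable_continuous_onI cont_\<phi>)
  have near: "(\<lambda>N. LINT y|lborel. indicator ?I y *\<^sub>R \<phi> N y) \<longlonglongrightarrow> 2 * pi * f x"
  proof -
    have "(\<lambda>N. integral ?I (\<lambda>y. of_real (fejer_kernel N (2 * pi * y / p)) * (f (x - y) * ?E y)))
        \<longlonglongrightarrow> of_real p * (f (x - 0) * ?E 0)"
      by (intro fejer_kernel_approximate_identity p continuous_intros cont_f cont_E)
    moreover have "integral ?I (\<lambda>y. of_real (fejer_kernel N (2 * pi * y / p)) * (f (x - y) * ?E y)) =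
        (LINT y|lborel. indicator ?I y *\<^sub>R \<phi> N y)" for N
    proof -
      have "2 * pi * y / p = s * y" for y using s by (simp add: p_def)
      then have "of_real (fejer_kernel N (2 * pi * y / p)) * (f (x - y) * ?E y) = \<phi> N y" for y
        unfolding \<phi>_def by (simp add: mult.left_commute)
      then show ?thesis by (simp only: integral_Icc_eq_lborel[OF cont_\<phi>])
    qed
    moreover have "of_real p * (f (x - 0) * ?E 0) = 2 * pi * f x"
      using s by (simp add: p_def scaleR_conv_of_real)
    ultimately show ?thesis by (simp only:)
  qed
  \<comment> \<open>The zeros of \<^term>\<open>?E\<close> at the nonzero multiples of p cancel the peaks of the Fejer kernel there.\<close>
  have bound: "cmod (of_real (fejer_kernel N (s * y)) * ?E y) \<le> 4 / p" if "y \<notin> ?I" for N y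
  proof -
    have y: "\<bar>y\<bar> > p/2" using that by auto
    then have "y \<noteq> 0" using p by auto
    then have "cmod (of_real (fejer_kernel N (s * y)) * ?E y) * \<bar>y\<bar> = 2 * (fejer_kernel N (s * y) * \<bar>sin (s * y / 2)\<bar>)"
      using norm_integral_cis_symmetric[OF s, of y] by (simp add: norm_mult fejer_kernel_nonneg mult.assoc)
    also have "\<dots> \<le> 2" using fejer_kernel_sin_le[of N "s * y"] by linarith
    also have "2 \<le> 4 / p * \<bar>y\<bar>" using y p by (simp add: field_simps)
    finally show ?thesis by (rule mult_right_le_imp_le) (use \<open>y \<noteq> 0\<close> in simp)
  qed
  have far: "(\<lambda>N. LINT y|lborel. indicator (- ?I) y *\<^sub>R \<phi> N y) \<longlonglongrightarrow> integral\<^sup>L (lborel :: real measure) (\<lambda>y. 0)"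
  proof (rule integral_dominated_convergence)
    show "integrable lborel (\<lambda>y. 4 / p * cmod (f (x - y)))" using fx by simp
    have "cmod (\<phi> N y) \<le> 4 / p * cmod (f (x - y))" if "y \<notin> ?I" for N y
      using mult_left_mono[OF bound[OF that, of N], of "cmod (f (x - y))"]
      by (simp only: \<phi>_def norm_mult mult_ac norm_ge_zero simp_thms)
    then show "AE y in lborel. cmod (indicator (- ?I) y *\<^sub>R \<phi> N y) \<le> 4 / p * cmod (f (x - y))" for N
      using p by (auto simp: indicator_def)
    \<comment> \<open>At nonzero multiples of \<open>p\<close> the window integral vanishes, so all
      \<open>\<phi> N y\<close> are 0; at other points the Fejer kernel itself tends to 0.\<close>
    have "(\<lambda>N. \<phi> N y) \<longlonglongrightarrow> 0" if y: "y \<notin> ?I" for y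
    proof (cases "sin (s * y / 2) = 0")
      case True
      moreover have "y \<noteq> 0" using y p by auto
      ultimately have "?E y = 0" using norm_integral_cis_symmetric[OF s, of y] by auto
      then show ?thesis by (simp add: \<phi>_def)
    next
      case False
      have "(\<lambda>N. fejer_kernel N (s * y)) \<longlonglongrightarrow> 0"
      proof (rule tendsto_sandwich[OF _ _ tendsto_const])
        show "\<forall>\<^sub>F N in sequentially. fejer_kernel N (s * y) \<le> inverse (real N) / (sin (s * y / 2))\<^sup>2"
        proof (intro always_eventually allI)
          have "(sin (s * y / 2))\<^sup>2 > 0" using False by simp
          from pos_le_divide_eq[OF this]
          show "fejer_kernel N (s * y) \<le> inverse (real N) / (sin (s * y / 2))\<^sup>2" for N
            using fejer_kernel_sin_sq_le[of N "s * y"] by (simp only: inverse_eq_divide)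
        qed
        show "(\<lambda>N. inverse (real N) / (sin (s * y / 2))\<^sup>2) \<longlonglongrightarrow> 0"
          using tendsto_divide[OF lim_inverse_n tendsto_const, of "(sin (s * y / 2))\<^sup>2"] False by simp
      qed (simp add: fejer_kernel_nonneg)
      then have "(\<lambda>N. complex_of_real (fejer_kernel N (s * y))) \<longlonglongrightarrow> of_real 0" by (rule tendsto_of_real)
      from tendsto_mult[OF tendsto_const tendsto_mult[OF this tendsto_const]]
      have "(\<lambda>N. \<phi> N y) \<longlonglongrightarrow> f (x - y) * (of_real 0 * ?E y)" unfolding \<phi>_def .
      then show ?thesis by simp
    qed
    then show "AE y in lborel. (\<lambda>N. indicator (- ?I) y *\<^sub>R \<phi> N y) \<longlonglongrightarrow> 0"
      by (auto simp: indicator_def)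
  qed auto
  \<comment> \<open>A crude bound growing with \<open>N\<close> is enough, since integrability only
    serves to split the integral for fixed \<open>N\<close>.\<close>
  have int: "integrable lborel (\<phi> N)" for N
  proof -
    have "cmod (of_real (fejer_kernel N (s * y)) * ?E y) \<le> real N * (s/2 - - (s/2))" for y
      unfolding norm_mult using s
      by (intro mult_mono norm_integral_cis) (auto simp: fejer_kernel_nonneg fejer_kernel_le)
    then show ?thesis unfolding \<phi>_def
      by (intro integrable_mult_bounded_continuous[OF fx] continuous_intros cont_E)
  qed
  have "(\<Sum>m<N. integral {- ((real m + 1/2) * s)..(real m + 1/2) * s}
        (\<lambda>v. unnormalized_fourier f v * cis (x * v))) / of_nat N =
      (LINT y|lborel. indicator ?I y *\<^sub>R \<phi> N y) + (LINT y|lborel. indicator (- ?I) y *\<^sub>R \<phi> N y)" for N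
  proof -
    have "\<phi> N y = indicator ?I y *\<^sub>R \<phi> N y + indicator (- ?I) y *\<^sub>R \<phi> N y" for y
      by (simp add: indicator_def)
    then have "(LINT y|lborel. \<phi> N y) = (LINT y|lborel. indicator ?I y *\<^sub>R \<phi> N y + indicator (- ?I) y *\<^sub>R \<phi> N y)"
      by (simp only: )
    also have "\<dots> = (LINT y|lborel. indicator ?I y *\<^sub>R \<phi> N y) + (LINT y|lborel. indicator (- ?I) y *\<^sub>R \<phi> N y)"
      by (intro Bochner_Integration.integral_add integrable_mult_indicator int) auto
    finally show ?thesis unfolding Cesaro_integral_fourier[OF f(1) s] \<phi>_def .
  qed
  then show ?thesis using tendsto_add[OF near far] by simp
qed

section \<open>Poisson summation and the quadrature remainder\<close>

text \<open>Integrability of \<open>f\<close> makes the samples converge and the coefficients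
  genuine integrals, namely values of the transform at \<open>- k * \<sigma>\<close>. Symmetric
  summation absorbs the sign.\<close>

lemma poisson_summation_bv:
  fixes f :: "real \<Rightarrow> complex"
  assumes f: "integrable lborel f" "continuous_on UNIV f" and bv: "bounded_variation f"
    and \<sigma>: "\<sigma> > 0" and h: "h = 2 * pi / \<sigma>"
  obtains S where "(\<lambda>N. \<Sum>k\<in>{- int N..int N}. f (of_int k * h)) \<longlonglongrightarrow> S"
    "(\<lambda>N. \<Sum>k\<in>{- int N..int N}. unnormalized_fourier f (of_int k * \<sigma>)) \<longlonglongrightarrow> of_real h * S"
proof -
  have h0: "h > 0" using \<sigma> h by simp
  from bv obtain V where V: "\<And>(n::nat) (x::nat \<Rightarrow> real). mono_on {..n} x \<Longrightarrow>
      (\<Sum>i<n. cmod (f (x (Suc i)) - f (x i))) \<le> V"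
    unfolding bounded_variation_def by blast
  interpret continuous_bv f V h
    by unfold_locales (use f V h0 in auto)
  obtain S where S: "(\<lambda>N. \<Sum>k\<in>{- int N..int N}. f (of_int k * h)) \<longlonglongrightarrow> S"
    by (rule convergent_samples[OF integral_symmetric_tendsto[OF f h0]])
  have "(\<lambda>M. integral {- ((real M + 1/2) * h)..(real M + 1/2) * h}
      (\<lambda>v. f v * cis (of_int k * (2 * pi * v / h)))) \<longlonglongrightarrow> unnormalized_fourier f (of_int (- k) * \<sigma>)" for k
  proof -
    have eq: "unnormalized_fourier f (of_int (- k) * \<sigma>) = (LINT v|lborel. f v * cis (of_int k * (2 * pi * v / h)))"
      using \<sigma> by (simp add: unnormalized_fourier_def h mult_ac)
    have int: "integrable lborel (\<lambda>v. f v * cis (of_int k * (2 * pi * v / h)))"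
      by (intro integrable_mult_cis f) measurable
    have cont: "continuous_on UNIV (\<lambda>v. f v * cis (of_int k * (2 * pi * v / h)))"
      using h0 by (intro continuous_intros) auto
    show ?thesis unfolding eq by (rule integral_symmetric_tendsto[OF int cont h0])
  qed
  from symmetric_sum_coefficients_tendsto[OF S this]
  have "(\<lambda>N. \<Sum>k\<in>{- int N..int N}. unnormalized_fourier f (of_int (- k) * \<sigma>)) \<longlonglongrightarrow> of_real h * S" .
  moreover have "(\<Sum>k\<in>{- int N..int N}. unnormalized_fourier f (of_int (- k) * \<sigma>)) =
      (\<Sum>k\<in>{- int N..int N}. unnormalized_fourier f (of_int k * \<sigma>))" for N
    by (rule sum.reindex_bij_witness[of _ uminus uminus]) auto
  ultimately show thesis using S by (intro that) simp_all
qed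

text \<open>Here the transform is periodized. It need not be integrable, so convergence of its
  samples enters as hypothesis \<open>T\<close>; in the application this comes from the finiteness
  of the right-hand side.\<close>

lemma poisson_summation_bv_transform:
  fixes f :: "real \<Rightarrow> complex"
  assumes f: "integrable lborel f" "continuous_on UNIV f" and bv: "bounded_variation (fourier_transform f)"
    and \<sigma>: "\<sigma> > 0" and h: "h = 2 * pi / \<sigma>"
    and T: "(\<lambda>N. \<Sum>k\<in>{- int N..int N}. unnormalized_fourier f (of_int k * \<sigma>)) \<longlonglongrightarrow> T"
  shows "(\<lambda>N. \<Sum>k\<in>{- int N..int N}. f (of_int k * h)) \<longlonglongrightarrow> T / of_real h"
proof -
  let ?c = "complex_of_real (sqrt (2 * pi))"
  have c: "?c \<noteq> 0" by simp
  have ft: "fourier_transform f = (\<lambda>v. unnormalized_fourier f v / ?c)"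
    by (simp add: fun_eq_iff fourier_transform_eq)
  from bv obtain V where V: "\<And>(n::nat) (x::nat \<Rightarrow> real). mono_on {..n} x \<Longrightarrow>
      (\<Sum>i<n. cmod (fourier_transform f (x (Suc i)) - fourier_transform f (x i))) \<le> V"
    unfolding bounded_variation_def by blast
  have cont: "continuous_on UNIV (fourier_transform f)"
    unfolding ft using c by (intro continuous_intros continuous_on_unnormalized_fourier f(1)) auto
  interpret continuous_bv "fourier_transform f" V \<sigma>
    by unfold_locales (use cont V \<sigma> in auto)
  have S: "(\<lambda>M. \<Sum>j\<in>{- int M..int M}. fourier_transform f (of_int j * \<sigma>)) \<longlonglongrightarrow> T / ?c"
    unfolding ft sum_divide_distrib[symmetric] by (intro tendsto_divide T tendsto_const c)
  obtain G where G: "continuous_on {- (\<sigma>/2)..\<sigma>/2} G"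
    "uniform_limit {- (\<sigma>/2)..\<sigma>/2} (\<lambda>M v. \<Sum>j\<in>{- int M..int M}. fourier_transform f (v + of_int j * \<sigma>)) G sequentially"
    by (rule uniform_limit_periodization[OF S])
  have "(\<lambda>M. integral {- ((real M + 1/2) * \<sigma>)..(real M + 1/2) * \<sigma>}
      (\<lambda>v. fourier_transform f v * cis (of_int k * (2 * pi * v / \<sigma>)))) \<longlonglongrightarrow> 2 * pi * f (of_int k * h) / ?c" for k
  proof -
    let ?J = "\<lambda>M. integral {- ((real M + 1/2) * \<sigma>)..(real M + 1/2) * \<sigma>}
      (\<lambda>v. fourier_transform f v * cis (of_int k * (2 * pi * v / \<sigma>)))"
    let ?L = "integral {- (\<sigma>/2)..\<sigma>/2} (\<lambda>v. G v * cis (of_int k * (2 * pi * v / \<sigma>)))"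
    have J: "?J M = integral {- ((real M + 1/2) * \<sigma>)..(real M + 1/2) * \<sigma>}
        (\<lambda>v. unnormalized_fourier f v * cis (of_int k * h * v)) / ?c" for M
    proof -
      have "fourier_transform f v * cis (of_int k * (2 * pi * v / \<sigma>)) =
          unnormalized_fourier f v * cis (of_int k * h * v) / ?c" for v
        by (simp add: ft h mult.assoc)
      then show ?thesis by (simp only: integral_divide)
    qed
    have lim: "?J \<longlonglongrightarrow> ?L" by (rule coefficients_tendsto[OF G])
    \<comment> \<open>Inversion gives only the Cesaro limit of \<open>?J\<close>; as
      \<open>?J\<close> also converges, the two limits coincide.\<close>
    have "(\<lambda>N. (\<Sum>M<N. ?J M) / of_nat N) \<longlonglongrightarrow> 2 * pi * f (of_int k * h) / ?c"
      unfolding J sum_divide_distrib[symmetric] divide_divide_eq_left mult.commute[of ?c]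
      unfolding divide_divide_eq_left[symmetric]
      by (intro tendsto_divide fourier_inversion_Cesaro f \<sigma> tendsto_const c)
    from LIMSEQ_unique[OF Cesaro_tendsto[OF lim] this] lim show ?thesis by (simp only:)
  qed
  from symmetric_sum_coefficients_tendsto[OF S this]
  have "(\<lambda>N. \<Sum>k\<in>{- int N..int N}. 2 * pi * f (of_int k * h) / ?c) \<longlonglongrightarrow> of_real \<sigma> * (T / ?c)" .
  then have "(\<lambda>N. ?c / (2 * pi) * (\<Sum>k\<in>{- int N..int N}. 2 * pi * f (of_int k * h) / ?c)) \<longlonglongrightarrow>
      ?c / (2 * pi) * (of_real \<sigma> * (T / ?c))"
    by (intro tendsto_mult tendsto_const)
  moreover have "?c / (2 * pi) * (\<Sum>k\<in>{- int N..int N}. 2 * pi * f (of_int k * h) / ?c) =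
      (\<Sum>k\<in>{- int N..int N}. f (of_int k * h))" for N
    by (simp add: sum_distrib_left)
  moreover have "?c / (2 * pi) * (of_real \<sigma> * (T / ?c)) = T / of_real h"
    using \<sigma> by (simp add: h)
  ultimately show ?thesis by (simp only:)
qed

section \<open>The estimate of the remainder\<close>

theorem theorem3p1:
  fixes f :: "real \<Rightarrow> complex" and r :: nat and \<sigma> :: real
  assumes "f \<in> class_A" and "r \<ge> 1" and "\<sigma> > 0"
  shows "ennreal (cmod (quadrature_remainder \<sigma> f)) \<le>
           ennreal (1 / 2 ^ (r - 1)) *
             (\<Sum>k. modulus_of_smoothness_L1 r f (pi / (\<sigma> * real (Suc k))))"
proof (cases "(\<Sum>k. modulus_of_smoothness_L1 r f (pi / (\<sigma> * real (Suc k)))) = top")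
  case True
  then show ?thesis by (simp add: ennreal_mult_top)
next
  case False
  let ?W = "\<lambda>k. modulus_of_smoothness_L1 r f (pi / (\<sigma> * real (Suc k)))"
  let ?F = "unnormalized_fourier f"
  define w where "w k = enn2real (?W k)" for k
  have f: "integrable lborel f" "continuous_on UNIV f"
    and bv: "bounded_variation f \<or> bounded_variation (fourier_transform f)"
    using assms(1) by (auto simp: class_A_def)
  have \<sigma>: "\<sigma> > 0" by fact
  define h where "h = 2 * pi / \<sigma>"
  have h0: "h > 0" using \<sigma> by (simp add: h_def)
  \<comment> \<open>Finiteness of the whole series forces each modulus to be finite, so
    \<open>enn2real\<close> loses nothing.\<close>
  have W: "?W k = ennreal (w k)" for k
    using ennreal_suminf_lessD[of ?W "top" k] False by (simp add: w_def less_top)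
  have w0: "w k \<ge> 0" for k by (simp add: w_def)
  have "summable w"
    using False unfolding W by (intro summable_suminf_not_top w0)
  have F_le: "cmod (?F v) \<le> w k / 2 ^ r" if "\<bar>v\<bar> = real (Suc k) * \<sigma>" for v k
  proof -
    have "v \<noteq> 0" using that \<sigma> by auto
    from unnormalized_fourier_le_modulus[OF f(1) this, of r] have "ennreal (2 ^ r * cmod (?F v)) \<le> ennreal (w k)"
      unfolding that W[symmetric] by (simp add: mult.commute)
    then show ?thesis using w0 by (simp add: field_simps)
  qed
  \<comment> \<open>Pairing opposite frequencies turns the symmetric sums into an ordinary series.
    The two terms per pair replace \<open>2 ^ r\<close> by \<open>2 ^ (r - 1)\<close> in the final
    bound.\<close>
  define d where "d i = ?F (of_int (int (Suc i)) * \<sigma>) + ?F (of_int (- int (Suc i)) * \<sigma>)" for i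
  have d_le: "cmod (d i) \<le> 2 * w i / 2 ^ r" for i
  proof -
    have "cmod (d i) \<le> w i / 2 ^ r + w i / 2 ^ r"
      unfolding d_def using \<sigma> by (intro norm_triangle_mono F_le) (simp_all add: abs_mult)
    then show ?thesis by (simp add: field_simps)
  qed
  have sum_w: "summable (\<lambda>i. 2 * w i / 2 ^ r)" using \<open>summable w\<close> by (intro summable_divide summable_mult)
  have "summable d"
    by (rule summable_comparison_test'[OF sum_w]) (rule d_le)
  have T: "(\<lambda>N. \<Sum>k\<in>{- int N..int N}. ?F (of_int k * \<sigma>)) \<longlonglongrightarrow> ?F 0 + suminf d"
    using tendsto_add[OF tendsto_const summable_LIMSEQ[OF \<open>summable d\<close>], of "?F 0"]
    unfolding sum_symmetric_eq d_def by simp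
  have lim: "(\<lambda>N. \<Sum>k\<in>{- int N..int N}. f (of_int k * h)) \<longlonglongrightarrow> (?F 0 + suminf d) / of_real h"
    using bv
  proof
    assume "bounded_variation f"
    then obtain S where S: "(\<lambda>N. \<Sum>k\<in>{- int N..int N}. f (of_int k * h)) \<longlonglongrightarrow> S"
      "(\<lambda>N. \<Sum>k\<in>{- int N..int N}. ?F (of_int k * \<sigma>)) \<longlonglongrightarrow> of_real h * S"
      by (rule poisson_summation_bv[OF f _ \<sigma> h_def])
    from LIMSEQ_unique[OF S(2) T] have "S = (?F 0 + suminf d) / of_real h"
      using h0 by (simp add: field_simps)
    with S(1) show ?thesis by simp
  next
    assume "bounded_variation (fourier_transform f)"
    then show ?thesis by (rule poisson_summation_bv_transform[OF f _ \<sigma> h_def T])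
  qed
  \<comment> \<open>The zero frequency \<open>?F 0\<close> is the integral of \<open>f\<close> and
    cancels; what is left is the sum over nonzero frequencies.\<close>
  have "quadrature_remainder \<sigma> f = ?F 0 - of_real h * ((?F 0 + suminf d) / of_real h)"
    using limI[OF lim]
    by (simp add: quadrature_remainder_def symmetric_int_sum_def h_def[symmetric] Let_def mult.commute[of h]
      unnormalized_fourier_def)
  also have "\<dots> = - suminf d" using h0 by simp
  finally have "cmod (quadrature_remainder \<sigma> f) = cmod (suminf d)" by simp
  also have "\<dots> \<le> (\<Sum>i. 2 * w i / 2 ^ r)"
    using summable_norm_comparison_test[OF _ sum_w] d_le
    by (intro order_trans[OF summable_norm suminf_le] sum_w) auto
  also have "\<dots> = 2 * suminf w / 2 ^ r"
    using \<open>summable w\<close> by (simp add: suminf_divide suminf_mult summable_mult)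
  also have "\<dots> = 1 / 2 ^ (r - 1) * suminf w"
    using assms(2) by (cases r) auto
  finally have "ennreal (cmod (quadrature_remainder \<sigma> f)) \<le> ennreal (1 / 2 ^ (r - 1)) * ennreal (suminf w)"
    using suminf_nonneg[OF \<open>summable w\<close> w0] by (simp add: ennreal_mult[symmetric] ennreal_leI)
  then show ?thesis unfolding W suminf_ennreal2[OF w0 \<open>summable w\<close>] .
qed

end
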